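(* Let $n,b\in\mathbb{N}$ with $1\le b<\frac n2$, and let $\xi_1,\dots,\xi_b$ be independent identically distributed real random variables with mean $a:=\mathbb{E}\xi_k$, variance $\sigma^2:=\mathbb{E}|\xi_k-a|^2$ with $0<\sigma^2<\infty$ (and $\sigma>0$), and third absolute central moment $\mu_3:=\mathbb{E}|\xi_k-a|^3<\infty$. Let $\mathbb{A}_{n,b}=\mathrm{Circ}(0,\xi_1,\dots,\xi_b,0,\dots,0,\xi_b,\dots,\xi_1)$ be the corresponding random real symmetric band circulant $n\times n$ matrix, and let $\mathcal{E}(\mathbb{A}_{n,b})=\mathrm{tr}|\mathbb{A}_{n,b}|$ be its trace norm. Then $$ \left|\frac1{n\sqrt{b}}\,\mathbb{E}\,\mathcal{E}(\mathbb{A}_{n,b})-\frac{2\sigma}{\sqrt{\pi}}\right| \leq\frac{8\pi C_1}{3\sqrt{3}}\,\frac{\mu_3}{\sigma^2\sqrt{b}} +\frac{4}{\sqrt{b}}\left(|a|+\frac{\sigma}{\sqrt{\pi b}}\right)\left(1+\frac1{\pi^2}\ln b\right) +\frac{2}{n\sqrt{b}}\left(|a|+\frac{2\sigma}{\sqrt{\pi b}}\right)\Big(1+(2b+1)(1+\gamma+\ln b)\Big), $$ where $C_1<31.954$ is the non-uniform Berry--Esseen constant and $\gamma$ is the Euler constant. Moreover, for a fixed distribution of the $\xi_k$, the right-hand side is $O\left(\frac{\ln b}{\sqrt b}\right)$ as $b\to\infty$ with $n>2b$.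
   Context: For $a_0,\dots,a_{n-1}\in\mathbb{C}$, $\mathrm{Circ}(a_0,\dots,a_{n-1})$ denotes the $n\times n$ circulant matrix whose $(i,j)$ entry is $a_{(j-i)\bmod n}$. In $\mathrm{Circ}(0,\xi_1,\dots,\xi_b,0,\dots,0,\xi_b,\dots,\xi_1)$ the generating tuple is $a_0=0$, $a_k=a_{n-k}=\xi_k$ for $1\le k\le b$, and $a_k=0$ for $b<k<n-b$; the number $b<n/2$ is the band width. The matrix energy (trace norm) of an $n\times n$ matrix $A$ is $\mathcal{E}(A):=\mathrm{tr}|A|=\mathrm{tr}\big((A^*A)^{1/2}\big)$, the sum of the singular values of $A$; for real symmetric $A$ it is the sum of the absolute values of the eigenvalues. $C_1$ is the best (smallest) absolute constant in the non-uniform Berry--Esseen inequality: for every $b\in\mathbb N$, all independent centered (not necessarily identically distributed) real random variables $X_1,\dots,X_b$ with finite third absolute moments and $B_b:=\sum_{k=1}^b\mathbb{E}|X_k|^2>0$, and all $x\in\mathbb{R}$, $$\left|\mathbb{P}\Big\{\tfrac1{\sqrt{B_b}}\sum_{k=1}^bX_k\le x\Big\}-\Phi_{0,1}(x)\right|\le C_1\,\frac{\sum_{k=1}^b\mathbb{E}|X_k|^3}{B_b^{3/2}}\,\frac1{1+|x|^3},$$ where $\Phi_{0,1}$ is the standard normal distribution function. It is known from the literature that $C_1<31.954$. *)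

theory Defs
  imports
    "HOL-Probability.Probability"
    "HOL-Library.Landau_Symbols"
    "Jordan_Normal_Form.Schur_Decomposition"
begin

text \<open>Constants named \<open>mat\<close>, \<open>vec\<close>, \<open>trace\<close>, ... also exist in HOL-Analysis for matrices whose
  dimensions are types. Here the dimension is a natural number, so all matrices are those of
  Jordan_Normal_Form.\<close>

definition circulant :: "nat \<Rightarrow> (nat \<Rightarrow> complex) \<Rightarrow> complex Matrix.mat" where
  "circulant n c = Matrix.mat n n (\<lambda>(i, j). c (nat ((int j - int i) mod int n)))"

definition band_tuple :: "nat \<Rightarrow> nat \<Rightarrow> (nat \<Rightarrow> real) \<Rightarrow> nat \<Rightarrow> complex" where
  "band_tuple n b x k =
     (if 1 \<le> k \<and> k \<le> b then complex_of_real (x k)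
      else if n - b \<le> k \<and> k < n then complex_of_real (x (n - k))
      else 0)"

definition band_circulant :: "nat \<Rightarrow> nat \<Rightarrow> (nat \<Rightarrow> real) \<Rightarrow> complex Matrix.mat" where
  "band_circulant n b x = circulant n (band_tuple n b x)"

definition mat_trace :: "complex Matrix.mat \<Rightarrow> complex" where
  "mat_trace A = (\<Sum>i<dim_row A. A $$ (i, i))"

definition positive_semidefinite :: "complex Matrix.mat \<Rightarrow> bool" where
  "positive_semidefinite A \<longleftrightarrow>
     square_mat A \<and> mat_adjoint A = A \<and>
     (\<forall>v \<in> carrier_vec (dim_row A). 0 \<le> Re ((A *\<^sub>v v) \<bullet>c v))"

text \<open>\<open>(A\<^sup>* A)\<^sup>1\<^sup>/\<^sup>2\<close>: the positive semidefinite square root, which exists and is unique.\<close>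

definition mat_abs :: "complex Matrix.mat \<Rightarrow> complex Matrix.mat" where
  "mat_abs A = (THE R. R \<in> carrier_mat (dim_col A) (dim_col A) \<and> positive_semidefinite R \<and>
                       R * R = mat_adjoint A * A)"

definition matrix_energy :: "complex Matrix.mat \<Rightarrow> real" where
  "matrix_energy A = Re (mat_trace (mat_abs A))"

text \<open>A definition cannot range over probability spaces of all types. The type
  \<open>nat \<Rightarrow> real\<close> loses nothing: the inequality depends only on the joint law of \<open>X 1, \<dots>, X b\<close>, and
  every such law is realised on a product of copies of the real line.\<close>

definition nonuniform_berry_esseen :: "real \<Rightarrow> bool" where
  "nonuniform_berry_esseen C \<longleftrightarrow>
     (\<forall>(M :: (nat \<Rightarrow> real) measure) (X :: nat \<Rightarrow> (nat \<Rightarrow> real) \<Rightarrow> real) (b :: nat).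
        prob_space M \<longrightarrow>
        prob_space.indep_vars M (\<lambda>_. borel) X {1..b} \<longrightarrow>
        (\<forall>k\<in>{1..b}. integrable M (\<lambda>\<omega>. \<bar>X k \<omega>\<bar> ^ 3)) \<longrightarrow>
        (\<forall>k\<in>{1..b}. integral\<^sup>L M (X k) = 0) \<longrightarrow>
        (let B = (\<Sum>k=1..b. \<integral>\<omega>. \<bar>X k \<omega>\<bar>\<^sup>2 \<partial>M) in
         0 < B \<longrightarrow>
         (\<forall>x::real.
            \<bar>measure M {\<omega> \<in> space M. (1 / sqrt B) * (\<Sum>k=1..b. X k \<omega>) \<le> x}
               - cdf std_normal_distribution x\<bar>
            \<le> C * ((\<Sum>k=1..b. \<integral>\<omega>. \<bar>X k \<omega>\<bar> ^ 3 \<partial>M) / B powr (3/2)) * (1 / (1 + \<bar>x\<bar> ^ 3)))))"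

definition best_nonuniform_berry_esseen :: "real \<Rightarrow> bool" where
  "best_nonuniform_berry_esseen C \<longleftrightarrow>
     nonuniform_berry_esseen C \<and> (\<forall>C'. nonuniform_berry_esseen C' \<longrightarrow> C \<le> C')"

end

theory Submission
  imports Defs "HOL-Real_Asymp.Real_Asymp"
begin

text \<open>The discrete Fourier matrix diagonalises every circulant matrix, so the energy is
  \<open>\<Sum>\<^sub>j \<bar>\<lambda>\<^sub>j\<bar>\<close> with \<open>\<lambda>\<^sub>j = 2 \<Sum>\<^sub>k \<xi>\<^sub>k cos (k t\<^sub>j)\<close> and \<open>t\<^sub>j = 2 \<pi> j / n\<close>. Centering \<open>\<xi>\<^sub>k\<close> costs
  \<open>2 \<bar>a\<bar> \<bar>C(t\<^sub>j)\<bar>\<close>, where \<open>C(t) = \<Sum>\<^sub>k cos (k t)\<close>. For a normalised centered sum \<open>Y\<close>, the difference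
  between \<open>E \<bar>Y\<bar>\<close> and its Gaussian counterpart is at most the \<open>L\<^sup>1\<close> distance of the distribution functions,
  which the non-uniform Berry--Esseen inequality bounds because \<open>1 / (1 + \<bar>x\<bar>\<^sup>3)\<close> has integral
  \<open>4 \<pi> / (3 \<surd>3)\<close>. The variance of the centered sum is \<open>\<sigma>\<^sup>2 (b + C(2 t\<^sub>j)) / 2\<close>, so replacing it by
  \<open>\<sigma>\<^sup>2 b / 2\<close> costs a multiple of \<open>\<bar>C(2 t\<^sub>j)\<bar>\<close>. The averages of \<open>\<bar>C(t\<^sub>j)\<bar>\<close> and \<open>\<bar>C(2 t\<^sub>j)\<bar>\<close> over \<open>j\<close> are
  Riemann sums: the integral of \<open>\<bar>C\<bar>\<close> is a Lebesgue constant, of order \<open>ln b\<close>, and the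
  discretisation error is controlled by the integral of \<open>\<bar>C'\<bar>\<close>.\<close>

section \<open>Averages of the Dirichlet kernel\<close>

definition cos_sum :: "nat \<Rightarrow> real \<Rightarrow> real" where
  "cos_sum b t = (\<Sum>k=1..b. cos (real k * t))"

definition cos_sum_deriv :: "nat \<Rightarrow> real \<Rightarrow> real" where
  "cos_sum_deriv b t = - (\<Sum>k=1..b. real k * sin (real k * t))"

lemma has_real_derivative_cos_sum:
  "(cos_sum b has_real_derivative cos_sum_deriv b t) (at t within S)"
  unfolding cos_sum_def [abs_def] cos_sum_deriv_def
  by (auto intro!: derivative_eq_intros simp: sum_negf [symmetric] mult.commute)

lemma continuous_on_cos_sum [continuous_intros]: "continuous_on S (cos_sum b)"
  unfolding cos_sum_def [abs_def] by (intro continuous_intros)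

lemma continuous_on_cos_sum_deriv [continuous_intros]: "continuous_on S (cos_sum_deriv b)"
  unfolding cos_sum_deriv_def [abs_def] by (intro continuous_intros)

lemma cos_sum_periodic: "cos_sum b (t + 2 * pi) = cos_sum b t"
proof -
  have "cos (real k * (t + 2 * pi)) = cos (real k * t)" for k
    using cos.plus_of_nat [of "real k * t" k] by (simp add: algebra_simps)
  then show ?thesis by (simp add: cos_sum_def)
qed

lemma cos_sum_deriv_periodic: "cos_sum_deriv b (t + 2 * pi) = cos_sum_deriv b t"
proof -
  have "sin (real k * (t + 2 * pi)) = sin (real k * t)" for k
    using sin.plus_of_nat [of "real k * t" k] by (simp add: algebra_simps)
  then show ?thesis by (simp add: cos_sum_deriv_def)
qed

lemma cos_sum_minus: "cos_sum b (- t) = cos_sum b t"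
  by (simp add: cos_sum_def)

lemma cos_sum_deriv_minus: "cos_sum_deriv b (- t) = - cos_sum_deriv b t"
  by (simp add: cos_sum_deriv_def sum_negf)

text \<open>The product telescopes, because \<open>2 * sin (t / 2) * cos (k * t) = sin ((k + 1/2) *
  t) - sin ((k - 1/2) * t)\<close>. With the factor \<open>sin (t / 2)\<close> kept on the left, the
  identity holds for every \<open>t\<close> and can be differentiated.\<close>

lemma cos_sum_closed_form:
  "2 * sin (t / 2) * cos_sum b t = sin ((real b + 1/2) * t) - sin (t / 2)"
proof (induction b)
  case 0
  then show ?case by (simp add: cos_sum_def)
next
  case (Suc b)
  have "2 * sin (t / 2) * cos (real (Suc b) * t)
      = sin ((real (Suc b) + 1/2) * t) - sin ((real b + 1/2) * t)"
  proof -
    have "(real (Suc b) + 1/2) * t = real (Suc b) * t + t / 2" "(real b + 1/2) * t = real (Suc b) * t - t / 2"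
      by (auto simp: field_simps)
    then show ?thesis by (simp only: sin_add sin_diff) simp
  qed
  with Suc show ?case by (simp add: cos_sum_def distrib_left)
qed

text \<open>Differentiating both sides of \<open>cos_sum_closed_form\<close> gives two expressions
  for one derivative.\<close>

lemma cos_sum_deriv_closed_form:
  "2 * sin (t / 2) * cos_sum_deriv b t
     = (real b + 1/2) * cos ((real b + 1/2) * t) - cos (t / 2) / 2 - cos (t / 2) * cos_sum b t"
proof -
  have 1: "((\<lambda>t. 2 * sin (t / 2) * cos_sum b t) has_real_derivative
        cos (t / 2) * cos_sum b t + 2 * sin (t / 2) * cos_sum_deriv b t) (at t)"
    by (auto intro!: derivative_eq_intros has_real_derivative_cos_sum)
  have 2: "((\<lambda>t. 2 * sin (t / 2) * cos_sum b t) has_real_derivative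
        (real b + 1/2) * cos ((real b + 1/2) * t) - cos (t / 2) / 2) (at t)"
    unfolding cos_sum_closed_form by (auto intro!: derivative_eq_intros)
  from DERIV_unique [OF 1 2] show ?thesis by simp
qed

section \<open>Lower bounds for the sine and upper bounds for its reciprocal\<close>

lemma sin_ge_linear:
  fixes x :: real
  assumes "0 \<le> x" "x \<le> pi / 2"
  shows "2 / pi * x \<le> sin x"
proof -
  \<comment> \<open>Jordan's inequality: the sine is concave here, so it lies above its chord from
    \<open>0\<close> to \<open>pi / 2\<close>, on which \<open>2 / pi * x\<close> is the
    parameter.\<close>
  have "convex_on {0..pi/2} (\<lambda>x. - sin x)"
  proof (rule f''_ge0_imp_convex)
    show "((\<lambda>x. - sin x) has_real_derivative - cos x) (at x)" for x :: real
      by (auto intro!: derivative_eq_intros)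
    show "((\<lambda>x. - cos x) has_real_derivative sin x) (at x)" for x :: real
      by (auto intro!: derivative_eq_intros)
    show "0 \<le> sin x" if "x \<in> {0..pi/2}" for x :: real
      using that by (intro sin_ge_zero) auto
  qed simp
  from convex_onD [OF this, of "2 / pi * x" 0 "pi / 2"] assms show ?thesis
    by (simp add: field_simps)
qed

text \<open>In \<open>1 / sin x - 1 / x = (x - sin x) / (x * sin x)\<close>, Taylor's formula bounds
  the numerator by \<open>x ^ 3 / 6\<close> and Jordan's inequality bounds the denominator below by
  \<open>2 / pi * x\<^sup>2\<close>. The error is additive and bounded, so the coefficient of
  \<open>1 / x\<close> stays \<open>1\<close>; this preserves the factor
  \<open>2 / pi\<^sup>2\<close> of \<open>ln b\<close> in the bound for the Lebesgue
  constant.\<close>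

lemma inverse_sin_le:
  fixes x :: real
  assumes "0 < x" "x \<le> pi / 2"
  shows "1 / sin x \<le> 1 / x + pi\<^sup>2 / 24"
proof -
  have s: "sin x > 0" using assms by (intro sin_gt_zero) auto
  have jordan: "2 / pi * x \<le> sin x"
    using sin_ge_linear assms by simp
  have "\<bar>sin x - x\<bar> \<le> x ^ 3 / 6"
    using Maclaurin_sin_bound [of x 3] assms
    by (simp add: numeral_3_eq_3 sin_coeff_def fact_numeral field_simps)
  then have "x - sin x \<le> x ^ 3 / 6" by linarith
  have "1 / sin x - 1 / x = (x - sin x) / (x * sin x)"
    using s assms by (simp add: field_simps)
  also have "\<dots> \<le> (x ^ 3 / 6) / (x * sin x)"
    using s assms \<open>x - sin x \<le> _\<close> by (intro divide_right_mono) auto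
  also have "\<dots> \<le> (x ^ 3 / 6) / (x * (2 / pi * x))"
    using s assms jordan by (intro divide_left_mono mult_left_mono mult_pos_pos) auto
  also have "\<dots> = pi / 12 * x"
    using assms by (simp add: field_simps power3_eq_cube)
  also have "\<dots> \<le> pi / 12 * (pi / 2)"
    using assms by (intro mult_left_mono) auto
  finally show ?thesis by (simp add: power2_eq_square)
qed

text \<open>A multiplicative bound from Jordan's inequality; it is precise enough for the derivative
  of the cosine sum.\<close>

lemma inverse_sin_half_le: 
  fixes t :: real
  assumes "0 < t" "t \<le> pi"
  shows "1 / sin (t / 2) \<le> pi / t"
proof -
  have "t / pi \<le> sin (t / 2)" using sin_ge_linear [of "t / 2"] assms by simp
  then have "inverse (sin (t / 2)) \<le> inverse (t / pi)"
    using assms by (intro le_imp_inverse_le) auto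
  then show ?thesis by (simp add: field_simps)
qed

section \<open>The Lebesgue constant: the integral of the absolute cosine sum\<close>

lemma integral_abs_sin_over_arg_le:
  fixes N :: real and k :: nat
  assumes "N > 0" "k \<ge> 1"
  shows "integral {real k * (pi / N)..real (Suc k) * (pi / N)} (\<lambda>t. \<bar>sin (N * t)\<bar> / t)
           \<le> 2 / (pi * real k)"
proof -
  define p where "p = pi / N"
  have p: "p > 0" "N * p = pi" using assms by (auto simp: p_def)
  let ?I = "{real k * p..real (Suc k) * p}"
  have le: "real k * p \<le> real (Suc k) * p" using p by simp
  have pos: "t > 0" if "t \<in> ?I" for t
    using that p assms by (auto intro: less_le_trans [of 0 "real k * p"])
  \<comment> \<open>The interval is one half-period of \<open>sin (N * t)\<close>. Shifting by
    \<open>k * pi\<close> reduces its sign to that of the sine on \<open>[0, pi]\<close>, so the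
    absolute value has an explicit antiderivative and integrates to \<open>2 / N\<close>.\<close>
  have sgn: "\<bar>sin (N * t)\<bar> = (- 1) ^ k * sin (N * t)" if "t \<in> ?I" for t
  proof -
    define s where "s = N * t - real k * pi"
    have "real k * pi \<le> N * t" "N * t \<le> real (Suc k) * pi"
      using that assms p mult_left_mono [of "real k * p" t N] mult_left_mono [of t "real (Suc k) * p" N]
      by (auto simp: mult.left_commute [of N])
    then have "0 \<le> s" "s \<le> pi" by (auto simp: s_def algebra_simps)
    then have "0 \<le> sin s" by (rule sin_ge_zero)
    have "sin (N * t) = sin (s + real k * pi)" by (simp add: s_def)
    also have "\<dots> = (- 1) ^ k * sin s" by (simp add: sin_add mult.commute)
    finally show ?thesis using \<open>0 \<le> sin s\<close> by (simp add: abs_mult power_mult_distrib [symmetric] flip: mult.assoc)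
  qed
  have "((\<lambda>t. (- 1) ^ k * sin (N * t)) has_integral
      (- ((- 1) ^ k * cos (N * (real (Suc k) * p)) / N)) - (- ((- 1) ^ k * cos (N * (real k * p)) / N))) ?I"
    using le assms
    by (intro fundamental_theorem_of_calculus)
       (auto intro!: derivative_eq_intros simp flip: has_real_derivative_iff_has_vector_derivative)
  also have "(- ((- 1) ^ k * cos (N * (real (Suc k) * p)) / N)) - (- ((- 1) ^ k * cos (N * (real k * p)) / N)) = 2 / N"
  proof -
    have "N * (real k * p) = real k * pi" "N * (real (Suc k) * p) = real (Suc k) * pi"
      using p by (auto simp: mult.left_commute)
    then show ?thesis by (simp only: cos_npi) simp
  qed
  finally have "((\<lambda>t. \<bar>sin (N * t)\<bar>) has_integral 2 / N) ?I"
    by (rule has_integral_eq [rotated]) (use sgn in simp)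
  then have J: "((\<lambda>t. \<bar>sin (N * t)\<bar> * (1 / (real k * p))) has_integral 2 / N * (1 / (real k * p))) ?I"
    by (rule has_integral_mult_left)
  \<comment> \<open>The factor \<open>1 / t\<close> is replaced by its value at the left end, which
    is finite because \<open>k \<ge> 1\<close>.\<close>
  have "integral ?I (\<lambda>t. \<bar>sin (N * t)\<bar> / t) \<le> integral ?I (\<lambda>t. \<bar>sin (N * t)\<bar> * (1 / (real k * p)))"
  proof (rule integral_le)
    show "(\<lambda>t. \<bar>sin (N * t)\<bar> / t) integrable_on ?I"
      using pos by (intro integrable_continuous_real continuous_intros) (metis less_irrefl)
    show "(\<lambda>t. \<bar>sin (N * t)\<bar> * (1 / (real k * p))) integrable_on ?I"
      using J by blast
    fix t assume t: "t \<in> ?I"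
    have "real k * p > 0" using p assms by auto
    then have "\<bar>sin (N * t)\<bar> / t \<le> \<bar>sin (N * t)\<bar> / (real k * p)"
      using t pos [OF t] by (intro divide_left_mono) auto
    then show "\<bar>sin (N * t)\<bar> / t \<le> \<bar>sin (N * t)\<bar> * (1 / (real k * p))" by simp
  qed
  also have "\<dots> = 2 / N * (1 / (real k * p))" using J by (rule integral_unique)
  also have "\<dots> = 2 / (pi * real k)" using p assms by (simp add: field_simps p_def)
  finally show ?thesis by (simp add: p_def)
qed

text \<open>The half-periods numbered \<open>1\<close> to \<open>m\<close> contribute
  \<open>2 / (pi * k)\<close> each. The half-period at the origin, where \<open>1 / t\<close> is
  unbounded, is left out.\<close>

lemma integral_abs_sin_over_arg_le_harm:
  fixes N :: real
  assumes "N > 0"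
  shows "integral {pi / N..real (Suc m) * (pi / N)} (\<lambda>t. \<bar>sin (N * t)\<bar> / t) \<le> 2 / pi * harm m"
proof (induction m)
  case 0
  then show ?case by (simp add: harm_def)
next
  case (Suc m)
  let ?f = "\<lambda>t. \<bar>sin (N * t)\<bar> / t"
  have p: "pi / N > 0" using assms by simp
  have "?f integrable_on {pi / N..real (Suc (Suc m)) * (pi / N)}"
    using p by (intro integrable_continuous_real continuous_intros) (auto simp del: of_nat_Suc zero_less_divide_iff)
  then have "integral {pi / N..real (Suc (Suc m)) * (pi / N)} ?f
     = integral {pi / N..real (Suc m) * (pi / N)} ?f
       + integral {real (Suc m) * (pi / N)..real (Suc (Suc m)) * (pi / N)} ?f"
    using p by (intro Henstock_Kurzweil_Integration.integral_combine [symmetric])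
      (auto intro!: mult_right_mono simp: mult_le_cancel_right1 simp del: times_divide_eq_right zero_less_divide_iff)
  also have "\<dots> \<le> 2 / pi * harm m + 2 / (pi * real (Suc m))"
    using Suc assms by (intro add_mono integral_abs_sin_over_arg_le) auto
  also have "\<dots> = 2 / pi * harm (Suc m)" by (simp add: harm_Suc distrib_left inverse_eq_divide)
  finally show ?case .
qed

text \<open>Dividing the closed form by \<open>2 * sin (t / 2)\<close> leaves half of
  \<open>\<bar>sin (N * t)\<bar> / sin (t / 2) + 1\<close> with \<open>N = b + 1/2\<close>. Then
  \<open>inverse_sin_le\<close> at \<open>t / 2\<close> replaces the reciprocal by
  \<open>2 / t + pi\<^sup>2 / 24\<close>, and the sine in front of the constant is bounded by
  \<open>1\<close>.\<close>

lemma abs_cos_sum_le: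
  assumes "0 < t" "t \<le> pi"
  shows "\<bar>cos_sum b t\<bar> \<le> 1 / 2 + pi\<^sup>2 / 48 + \<bar>sin ((real b + 1/2) * t)\<bar> / t"
proof -
  have s: "sin (t / 2) > 0" using assms by (intro sin_gt_zero) auto
  let ?S = "\<bar>sin ((real b + 1/2) * t)\<bar>"
  have "2 * sin (t / 2) * \<bar>cos_sum b t\<bar> = \<bar>2 * sin (t / 2) * cos_sum b t\<bar>"
    using s by (simp add: abs_mult)
  also have "\<dots> \<le> ?S + sin (t / 2)"
    unfolding cos_sum_closed_form using s by linarith
  finally have "\<bar>cos_sum b t\<bar> \<le> (?S * (1 / sin (t / 2)) + 1) / 2"
    using s by (simp add: field_simps)
  also have "?S * (1 / sin (t / 2)) \<le> ?S * (2 / t + pi\<^sup>2 / 24)"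
    using inverse_sin_le [of "t / 2"] assms by (intro mult_left_mono) auto
  also have "\<dots> \<le> 2 * ?S / t + pi\<^sup>2 / 24"
    using mult_right_mono [of ?S 1 "pi\<^sup>2 / 24"] by (simp add: algebra_simps)
  finally show ?thesis by (simp add: field_simps)
qed

text \<open>The sequence \<open>harm n - ln n\<close> decreases, and its value at
  \<open>n = 1\<close> is \<open>1\<close>.\<close>

lemma harm_le_ln: "n \<ge> 1 \<Longrightarrow> harm n \<le> 1 + ln (real n)"
  using euler_mascheroni_sequence_decreasing [of 1 n] by (simp add: harm_def)

text \<open>The integral is split at \<open>p = pi / N\<close>, the first positive zero of
  \<open>sin (N * t)\<close>. Up to \<open>p\<close>, the bound
  \<open>\<bar>sin (N * t)\<bar> / t \<le> N\<close> contributes \<open>N * p = pi\<close>; beyond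
  \<open>p\<close>, the half-periods add up to a harmonic number. The bounded part of the pointwise
  estimate contributes \<open>c * pi\<close> over the whole interval.\<close>

lemma integral_abs_cos_sum_le:
  assumes "b \<ge> 1"
  shows "integral {0..pi} (\<lambda>t. \<bar>cos_sum b t\<bar>) \<le> pi * (2 + 2 / pi\<^sup>2 * ln (real b))"
proof -
  define N where "N = real b + 1/2"
  define p where "p = pi / N"
  define c where "c = 1 / 2 + pi\<^sup>2 / 48"
  have N: "N > 1" using assms by (simp add: N_def)
  have p: "p > 0" "p \<le> pi" "N * p = pi" using N by (auto simp: p_def field_simps)
  \<comment> \<open>The \<open>b\<close> half-periods that follow \<open>p\<close> reach at least to
    \<open>pi\<close>. What they cover beyond \<open>pi\<close> only enlarges the integral of a
    nonnegative function.\<close>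
  have p1: "pi \<le> real (Suc b) * p"
    using N by (simp add: p_def N_def field_simps)
  let ?f = "\<lambda>t. \<bar>sin (N * t)\<bar> / t"
  have intC: "(\<lambda>t. \<bar>cos_sum b t\<bar>) integrable_on {x..y}" for x y
    by (intro integrable_continuous_real continuous_intros)
  have intf: "?f integrable_on {p..y}" for y
    using p by (intro integrable_continuous_real continuous_intros) auto
  have "integral {0..pi} (\<lambda>t. \<bar>cos_sum b t\<bar>)
      = integral {0..p} (\<lambda>t. \<bar>cos_sum b t\<bar>) + integral {p..pi} (\<lambda>t. \<bar>cos_sum b t\<bar>)"
    using p intC by (intro Henstock_Kurzweil_Integration.integral_combine [symmetric]) auto
  also have "integral {0..p} (\<lambda>t. \<bar>cos_sum b t\<bar>) \<le> integral {0..p} (\<lambda>t. c + N)"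
  proof (rule integral_le)
    fix t assume t: "t \<in> {0..p}"
    show "\<bar>cos_sum b t\<bar> \<le> c + N"
    proof (cases "t = 0")
      case True
      then show ?thesis by (simp add: cos_sum_def N_def c_def)
    next
      case False
      then have "t > 0" using t by simp
      then have "?f t \<le> N"
        using abs_sin_x_le_abs_x [of "N * t"] N by (simp add: field_simps abs_mult)
      moreover have "\<bar>cos_sum b t\<bar> \<le> c + ?f t"
        using abs_cos_sum_le [of t b] \<open>t > 0\<close> t p by (simp add: c_def N_def)
      ultimately show ?thesis by linarith
    qed
  qed (use intC in auto)
  also have "\<dots> = c * p + pi" using p by (simp add: algebra_simps)
  also have "integral {p..pi} (\<lambda>t. \<bar>cos_sum b t\<bar>) \<le> integral {p..pi} (\<lambda>t. c + ?f t)"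
  proof (rule integral_le)
    fix t assume t: "t \<in> {p..pi}"
    then show "\<bar>cos_sum b t\<bar> \<le> c + ?f t"
      using abs_cos_sum_le [of t b] p by (simp add: c_def N_def)
  qed (use intC intf in \<open>auto intro!: integrable_add\<close>)
  also have "\<dots> = c * (pi - p) + integral {p..pi} ?f"
    using intf p by (subst Henstock_Kurzweil_Integration.integral_add) auto
  also have "integral {p..pi} ?f \<le> integral {p..real (Suc b) * p} ?f"
    using p p1 intf by (intro integral_subset_le) auto
  also have "\<dots> \<le> 2 / pi * harm b"
    using integral_abs_sin_over_arg_le_harm [of N b] N by (simp add: p_def)
  also have "\<dots> \<le> 2 / pi * (1 + ln (real b))"
    using assms by (intro mult_left_mono harm_le_ln) auto
  finally have "integral {0..pi} (\<lambda>t. \<bar>cos_sum b t\<bar>) \<le> (c + 1) * pi + 2 / pi * (1 + ln (real b))"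
    by (simp add: algebra_simps)
  also have "\<dots> \<le> pi * (2 + 2 / pi\<^sup>2 * ln (real b))"
  proof -
    \<comment> \<open>The estimates \<open>3 \<le> pi \<le> 16/5\<close> suffice to absorb all
      constants: \<open>c + 1 + 2 / pi\<^sup>2\<close> is then below \<open>1.94\<close>.\<close>
    have "pi\<^sup>2 \<le> (16/5)\<^sup>2" using pi_approx by (intro power_mono) auto
    moreover have "3\<^sup>2 \<le> pi\<^sup>2" using pi_approx by (intro power_mono) auto
    then have "2 / pi\<^sup>2 \<le> 2 / 9" by (intro divide_left_mono) auto
    ultimately have "c + 1 + 2 / pi\<^sup>2 \<le> 2" by (simp add: c_def power2_eq_square)
    then have "pi * (c + 1 + 2 / pi\<^sup>2) \<le> pi * 2" by (intro mult_left_mono) auto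
    then show ?thesis by (simp add: algebra_simps power2_eq_square add_divide_distrib)
  qed
  finally show ?thesis .
qed

section \<open>The integral of the absolute derivative of the cosine sum\<close>

lemma abs_cos_sum_deriv_le:
  "\<bar>cos_sum_deriv b t\<bar> \<le> real b * (real b + 1) / 2"
proof -
  have "\<bar>cos_sum_deriv b t\<bar> \<le> (\<Sum>k=1..b. \<bar>real k * sin (real k * t)\<bar>)"
    unfolding cos_sum_deriv_def abs_minus_cancel by (rule sum_abs)
  also have "\<dots> \<le> (\<Sum>k=1..b. real k)"
    by (intro sum_mono) (auto simp: abs_mult intro!: mult_left_le)
  also have "\<dots> = real b * (real b + 1) / 2"
    by (induction b) (auto simp: field_simps)
  finally show ?thesis .
qed

text \<open>Inserting the closed form of the sum into that of its derivative cancels the two terms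
  \<open>cos (t / 2) / 2\<close>. With \<open>s = sin (t / 2)\<close>, one term of order
  \<open>N / s\<close> and one of order \<open>1 / s\<^sup>2\<close> remain.\<close>

lemma abs_cos_sum_deriv_le':
  assumes "0 < t" "t \<le> pi"
  shows "\<bar>cos_sum_deriv b t\<bar> \<le> (real b + 1/2) * pi / (2 * t) + pi\<^sup>2 / (4 * t\<^sup>2)"
proof -
  define N where "N = real b + 1/2"
  define s where "s = sin (t / 2)"
  have s: "s > 0" unfolding s_def using assms by (intro sin_gt_zero) auto
  have s1: "1 / s \<le> pi / t" unfolding s_def using assms by (rule inverse_sin_half_le)
  have C: "cos_sum b t = sin (N * t) / (2 * s) - 1 / 2"
    using cos_sum_closed_form [of t b] s by (simp add: s_def N_def field_simps)
  have "cos_sum_deriv b t = (N * cos (N * t) - cos (t / 2) / 2 - cos (t / 2) * cos_sum b t) / (2 * s)"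
    using cos_sum_deriv_closed_form [of t b] s by (simp add: s_def N_def field_simps)
  also have "\<dots> = N / 2 * cos (N * t) * (1 / s) - (cos (t / 2) * sin (N * t)) / 4 * (1 / s)\<^sup>2"
    unfolding C using s by (simp add: field_simps power2_eq_square)
  finally have "\<bar>cos_sum_deriv b t\<bar> \<le> \<bar>N / 2 * cos (N * t) * (1 / s)\<bar> + \<bar>(cos (t / 2) * sin (N * t)) / 4 * (1 / s)\<^sup>2\<bar>"
    using abs_triangle_ineq4 by metis
  also have "\<bar>N / 2 * cos (N * t) * (1 / s)\<bar> \<le> N / 2 * 1 * (pi / t)"
    unfolding abs_mult using s s1 by (intro mult_mono) (auto simp: N_def)
  also have "\<bar>(cos (t / 2) * sin (N * t)) / 4 * (1 / s)\<^sup>2\<bar> \<le> (1 * 1) / 4 * (pi / t)\<^sup>2"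
    unfolding abs_mult abs_divide using s s1
    by (intro mult_mono divide_right_mono) (auto intro!: power_mono mult_le_one)
  finally show ?thesis by (simp add: N_def power_divide)
qed

lemma integral_abs_cos_sum_deriv_le:
  assumes "b \<ge> 1"
  shows "integral {0..pi} (\<lambda>t. \<bar>cos_sum_deriv b t\<bar>)
           \<le> 1 + (2 * real b + 1) * (1 + euler_mascheroni + ln (real b))"
proof -
  define N where "N = real b + 1/2"
  \<comment> \<open>Near \<open>0\<close> the trivial bound of order \<open>b\<^sup>2\<close> is the
    better one, further out the bound in powers of \<open>1 / t\<close>; they are comparable at
    \<open>t\<close> of order \<open>1 / b\<close>. With \<open>q = 2 / b\<close> the trivial part
    contributes exactly \<open>b + 1\<close>.\<close>
  define q where "q = 2 / real b"
  have b: "real b \<ge> 1" using assms by simp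
  have "q \<le> 2 / 1" unfolding q_def using b by (intro divide_left_mono) auto
  then have q: "q > 0" "q \<le> pi" using b pi_gt3 by (auto simp: q_def)
  have int: "(\<lambda>t. \<bar>cos_sum_deriv b t\<bar>) integrable_on {x..y}" for x y
    by (intro integrable_continuous_real continuous_intros)
  let ?g = "\<lambda>t. N * pi / (2 * t) + pi\<^sup>2 / (4 * t\<^sup>2)"
  let ?G = "\<lambda>t. N * pi / 2 * ln t - pi\<^sup>2 / (4 * t)"
  have g: "(?g has_integral ?G pi - ?G q) {q..pi}"
    using q
    by (intro fundamental_theorem_of_calculus)
       (auto intro!: derivative_eq_intros simp: field_simps power2_eq_square
             simp flip: has_real_derivative_iff_has_vector_derivative)
  have "integral {0..pi} (\<lambda>t. \<bar>cos_sum_deriv b t\<bar>)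
      = integral {0..q} (\<lambda>t. \<bar>cos_sum_deriv b t\<bar>) + integral {q..pi} (\<lambda>t. \<bar>cos_sum_deriv b t\<bar>)"
    using q int by (intro Henstock_Kurzweil_Integration.integral_combine [symmetric]) auto
  also have "integral {0..q} (\<lambda>t. \<bar>cos_sum_deriv b t\<bar>) \<le> integral {0..q} (\<lambda>t. real b * (real b + 1) / 2)"
    using int abs_cos_sum_deriv_le by (intro integral_le) auto
  also have "\<dots> = real b + 1" using q b by (simp add: q_def)
  also have "integral {q..pi} (\<lambda>t. \<bar>cos_sum_deriv b t\<bar>) \<le> integral {q..pi} ?g"
  proof (rule integral_le)
    fix t assume "t \<in> {q..pi}"
    then show "\<bar>cos_sum_deriv b t\<bar> \<le> ?g t"
      using abs_cos_sum_deriv_le' [of t b] q by (simp add: N_def)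
  qed (use int g in auto)
  also have "\<dots> = ?G pi - ?G q" using g by (rule integral_unique)
  also have "\<dots> \<le> N * pi / 2 * (ln (real b) + ln (pi / 2)) + pi\<^sup>2 * real b / 8"
    using b by (simp add: q_def ln_div right_diff_distrib distrib_left)
  also have "ln (pi / 2) \<le> pi / 2 - 1" by (rule ln_le_minus_one) simp
  finally have 1: "integral {0..pi} (\<lambda>t. \<bar>cos_sum_deriv b t\<bar>)
      \<le> real b + 1 + (N * pi / 2 * (ln (real b) + (pi / 2 - 1)) + pi\<^sup>2 * real b / 8)"
    by (simp add: N_def)
  have pi: "pi \<le> 63/20" using pi_approx by simp
  have pi2: "pi\<^sup>2 \<le> (63/20)\<^sup>2" using pi by (intro power_mono) auto
  have e: "euler_mascheroni \<ge> (19/33 :: real)" using euler_mascheroni_gt_19_over_33 by simp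
  have lnb: "ln (real b) \<ge> 0" using b by simp
  have "N * pi / 2 * ln (real b) \<le> 2 * N * ln (real b)"
    using pi lnb mult_left_mono [of pi 4 N] by (intro mult_right_mono) (auto simp: N_def)
  moreover have "N * pi / 2 * (pi / 2 - 1) \<le> N * (63/40 * (23/40))"
  proof -
    have "pi / 2 * (pi / 2 - 1) \<le> 63/40 * (23/40)"
      using pi pi_gt3 by (intro mult_mono) auto
    from mult_left_mono [OF this, of N] show ?thesis by (simp add: N_def algebra_simps)
  qed
  moreover have "pi\<^sup>2 * real b / 8 \<le> (63/20)\<^sup>2 * real b / 8"
    using pi2 by (intro divide_right_mono mult_right_mono) auto
  moreover have "2 * N * (1 + 19/33) \<le> 2 * N * (1 + euler_mascheroni)"
    using e by (intro mult_left_mono) (auto simp: N_def)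
  \<comment> \<open>The numerical margin is narrow: the coefficient of \<open>b\<close> is about
    \<open>3.146\<close> on the left and \<open>3.152\<close> on the right. This determines the
    accuracy demanded of \<open>pi \<le> 63/20\<close> and of
    \<open>euler_mascheroni \<ge> 19/33\<close>.\<close>
  moreover have "real b + 1 + N * (63/40 * (23/40)) + (63/20)\<^sup>2 * real b / 8 \<le> 1 + 2 * N * (1 + 19/33)"
    using b by (simp add: N_def power2_eq_square field_simps)
  moreover have "N * pi / 2 * (ln (real b) + (pi / 2 - 1))
      = N * pi / 2 * ln (real b) + N * pi / 2 * (pi / 2 - 1)"
    by (rule distrib_left)
  ultimately have "real b + 1 + (N * pi / 2 * (ln (real b) + (pi / 2 - 1)) + pi\<^sup>2 * real b / 8)
      \<le> 1 + 2 * N * (1 + euler_mascheroni) + 2 * N * ln (real b)"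
    by linarith
  also have "\<dots> = 1 + (2 * real b + 1) * (1 + euler_mascheroni + ln (real b))"
    by (simp add: N_def algebra_simps)
  finally show ?thesis using 1 by linarith
qed

section \<open>From integrals to sums over equidistant nodes\<close>

lemma trapezoid_abs_le:
  fixes f f' :: "real \<Rightarrow> real"
  assumes "l \<le> r"
    and f: "\<And>t. (f has_real_derivative f' t) (at t)"
    and f': "continuous_on {l..r} f'"
  shows "(r - l) * (\<bar>f l\<bar> + \<bar>f r\<bar>)
           \<le> 2 * integral {l..r} (\<lambda>t. \<bar>f t\<bar>) + (r - l) * integral {l..r} (\<lambda>t. \<bar>f' t\<bar>)"
proof -
  let ?V = "integral {l..r} (\<lambda>t. \<bar>f' t\<bar>)"
  have cf: "continuous_on S f" for S
    using f by (meson DERIV_isCont continuous_at_imp_continuous_on)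
  have int: "(\<lambda>t. \<bar>f' t\<bar>) integrable_on {x..y}" if "l \<le> x" "y \<le> r" for x y
    using that by (intro integrable_continuous_real continuous_intros continuous_on_subset [OF f']) auto
  have diff: "\<bar>f y - f x\<bar> \<le> integral {x..y} (\<lambda>t. \<bar>f' t\<bar>)" if "l \<le> x" "x \<le> y" "y \<le> r" for x y
  proof -
    have "(f' has_integral f y - f x) {x..y}"
      using that f by (intro fundamental_theorem_of_calculus)
        (auto intro: has_field_derivative_at_within simp flip: has_real_derivative_iff_has_vector_derivative)
    with int [of x y] that show ?thesis
      by (metis has_integral_iff integral_norm_bound_integral order_refl real_norm_def)
  qed
  \<comment> \<open>Comparing \<open>f l\<close> with \<open>f t\<close> costs the variation on
    \<open>[l, t]\<close>, and comparing \<open>f r\<close> with \<open>f t\<close> costs that on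
    \<open>[t, r]\<close>. Together they make the variation \<open>?V\<close> once, not twice.
    Averaging over \<open>t\<close> then gives the claim.\<close>
  have "\<bar>f l\<bar> + \<bar>f r\<bar> \<le> 2 * \<bar>f t\<bar> + ?V" if "t \<in> {l..r}" for t
  proof -
    have "?V = integral {l..t} (\<lambda>t. \<bar>f' t\<bar>) + integral {t..r} (\<lambda>t. \<bar>f' t\<bar>)"
      using that int by (intro Henstock_Kurzweil_Integration.integral_combine [symmetric]) auto
    then show ?thesis using diff [of l t] diff [of t r] that by auto
  qed
  then have "integral {l..r} (\<lambda>t. \<bar>f l\<bar> + \<bar>f r\<bar>) \<le> integral {l..r} (\<lambda>t. 2 * \<bar>f t\<bar> + ?V)"
    using cf by (intro integral_le integrable_continuous_real continuous_intros) auto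
  also have "\<dots> = 2 * integral {l..r} (\<lambda>t. \<bar>f t\<bar>) + (r - l) * ?V"
    using cf assms by (subst Henstock_Kurzweil_Integration.integral_add)
      (auto intro!: integrable_continuous_real continuous_intros)
  finally show ?thesis using assms by simp
qed

lemma sum_trapezoid_abs_le:
  fixes f f' :: "real \<Rightarrow> real"
  assumes "h \<ge> 0"
    and f: "\<And>t. (f has_real_derivative f' t) (at t)"
    and f': "\<And>S. continuous_on S f'"
  shows "h * (\<Sum>j<n. \<bar>f (real j * h)\<bar> + \<bar>f (real (Suc j) * h)\<bar>)
           \<le> 2 * integral {0..real n * h} (\<lambda>t. \<bar>f t\<bar>) + h * integral {0..real n * h} (\<lambda>t. \<bar>f' t\<bar>)"
proof (induction n)
  case (Suc n)
  have cf: "continuous_on S f" for S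
    using f by (meson DERIV_isCont continuous_at_imp_continuous_on)
  have split: "integral {0..real (Suc n) * h} (\<lambda>t. \<bar>g t\<bar>)
      = integral {0..real n * h} (\<lambda>t. \<bar>g t\<bar>) + integral {real n * h..real (Suc n) * h} (\<lambda>t. \<bar>g t\<bar>)"
    if "\<And>S. continuous_on S g" for g :: "real \<Rightarrow> real"
    using that assms(1)
    by (intro Henstock_Kurzweil_Integration.integral_combine [symmetric] integrable_continuous_real continuous_intros)
       (auto simp: algebra_simps)
  have "h * (\<bar>f (real n * h)\<bar> + \<bar>f (real (Suc n) * h)\<bar>)
     \<le> 2 * integral {real n * h..real (Suc n) * h} (\<lambda>t. \<bar>f t\<bar>)
       + h * integral {real n * h..real (Suc n) * h} (\<lambda>t. \<bar>f' t\<bar>)"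
    using trapezoid_abs_le [of "real n * h" "real (Suc n) * h" f f'] f f' assms(1)
    by (simp add: algebra_simps)
  with Suc split [OF cf] split [OF f'] show ?case
    by (simp only: sum.lessThan_Suc distrib_left)
qed simp

text \<open>All periods contribute equally. Within one, the second half is shifted to
  \<open>[- pi, 0]\<close> and reflected onto the first.\<close>

lemma integral_even_periodic:
  fixes g :: "real \<Rightarrow> real"
  assumes "continuous_on UNIV g" and per: "\<And>t. g (t + 2 * pi) = g t" and ev: "\<And>t. g (- t) = g t"
  shows "integral {0..2 * pi * real m} g = 2 * real m * integral {0..pi} g"
proof (induction m)
  case (Suc m)
  have int: "g integrable_on {x..y}" for x y
    using assms(1) by (intro integrable_continuous_real) (rule continuous_on_subset, auto)
  have shift: "integral {x + 2 * pi..y + 2 * pi} g = integral {x..y} g" for x y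
    using integral_shift_real_ivl [of "x + 2 * pi" "2 * pi" "y + 2 * pi" g] per by simp
  have "integral {0..2 * pi * real (Suc m)} g
      = integral {0..2 * pi} g + integral {2 * pi..2 * pi * real (Suc m)} g"
    using int by (intro Henstock_Kurzweil_Integration.integral_combine [symmetric]) (auto simp: algebra_simps)
  also have "integral {2 * pi..2 * pi * real (Suc m)} g = integral {0..2 * pi * real m} g"
    using shift [of 0 "2 * pi * real m"] by (simp add: algebra_simps)
  also have "integral {0..2 * pi} g = integral {0..pi} g + integral {pi..2 * pi} g"
    using int by (intro Henstock_Kurzweil_Integration.integral_combine [symmetric]) auto
  also have "integral {pi..2 * pi} g = integral {- pi..0} g"
    using shift [of "- pi" 0] by simp
  also have "\<dots> = integral {0..pi} g"
    using Henstock_Kurzweil_Integration.integral_reflect_real [of pi 0 g] ev by simp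
  finally show ?case using Suc by (simp add: algebra_simps)
qed simp

text \<open>The nodes \<open>j * h\<close> with \<open>h = 2 * pi * m / n\<close> go round the
  circle \<open>m\<close> times. The average of the integral over \<open>m\<close> circuits is that
  over one, but the discretisation error is proportional to \<open>h\<close> and so acquires the
  factor \<open>m\<close>. The case \<open>m = 1\<close> serves \<open>C(t\<^sub>j)\<close> and
  \<open>m = 2\<close> serves \<open>C(2 t\<^sub>j)\<close>.\<close>

lemma sum_abs_cos_sum_le:
  assumes "b \<ge> 1" "n \<ge> 1" "m \<ge> 1"
  shows "(\<Sum>j<n. \<bar>cos_sum b (2 * pi * real m * real j / real n)\<bar>) / real n
           \<le> 2 + 2 / pi\<^sup>2 * ln (real b)
             + real m / real n * (1 + (2 * real b + 1) * (1 + euler_mascheroni + ln (real b)))"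
proof -
  define h where "h = 2 * pi * real m / real n"
  have h: "h > 0" "real n * h = 2 * pi * real m" using assms by (auto simp: h_def)
  let ?f = "\<lambda>j. \<bar>cos_sum b (real j * h)\<bar>"
  let ?IA = "integral {0..pi} (\<lambda>t. \<bar>cos_sum b t\<bar>)"
  let ?IB = "integral {0..pi} (\<lambda>t. \<bar>cos_sum_deriv b t\<bar>)"
  \<comment> \<open>The node \<open>n * h\<close> is a multiple of the period, so the end values
    agree and the trapezoidal sum is twice the plain sum over \<open>j < n\<close>.\<close>
  have ends: "?f n = ?f 0"
  proof -
    have "cos_sum b (2 * pi * real i) = cos_sum b 0" for i
    proof (induction i)
      case (Suc i)
      then show ?case using cos_sum_periodic [of b "2 * pi * real i"] by (simp add: algebra_simps)
    qed simp
    then show ?thesis using h by simp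
  qed
  have "(\<Sum>j<n. ?f (Suc j)) = (\<Sum>j<n. ?f j) + ?f n - ?f 0"
    using sum.lessThan_Suc_shift [of ?f n] sum.lessThan_Suc [of ?f n] by simp
  with ends have "(\<Sum>j<n. ?f j + ?f (Suc j)) = 2 * (\<Sum>j<n. ?f j)"
    by (simp add: sum.distrib)
  moreover have "h * (\<Sum>j<n. ?f j + ?f (Suc j))
     \<le> 2 * integral {0..2 * pi * real m} (\<lambda>t. \<bar>cos_sum b t\<bar>)
       + h * integral {0..2 * pi * real m} (\<lambda>t. \<bar>cos_sum_deriv b t\<bar>)"
    using sum_trapezoid_abs_le [of h "cos_sum b" "cos_sum_deriv b" n] h
    by (simp add: has_real_derivative_cos_sum continuous_on_cos_sum_deriv)
  moreover have "integral {0..2 * pi * real m} (\<lambda>t. \<bar>cos_sum b t\<bar>) = 2 * real m * ?IA"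
    by (intro integral_even_periodic continuous_intros) (auto simp: cos_sum_periodic cos_sum_minus)
  moreover have "integral {0..2 * pi * real m} (\<lambda>t. \<bar>cos_sum_deriv b t\<bar>) = 2 * real m * ?IB"
    by (intro integral_even_periodic continuous_intros)
       (auto simp: cos_sum_deriv_periodic cos_sum_deriv_minus)
  ultimately have "2 * h * (\<Sum>j<n. ?f j) \<le> 4 * real m * ?IA + 2 * h * real m * ?IB" by simp
  then have "real n * (2 * h * (\<Sum>j<n. ?f j)) \<le> real n * (4 * real m * ?IA + 2 * h * real m * ?IB)"
    by (rule mult_left_mono) simp
  also have "real n * (2 * h * (\<Sum>j<n. ?f j)) = 4 * real m * (pi * (\<Sum>j<n. ?f j))"
    using h(2) by (simp add: mult.assoc [symmetric] mult.commute [of 2])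
  also have "real n * (4 * real m * ?IA + 2 * h * real m * ?IB)
      = 4 * real m * (real n * ?IA) + 2 * (real n * h) * real m * ?IB"
    by (simp add: distrib_left)
  also have "\<dots> = 4 * real m * (real n * ?IA + pi * real m * ?IB)"
    unfolding h(2) by (simp add: distrib_left)
  finally have "pi * (\<Sum>j<n. ?f j) \<le> real n * ?IA + pi * real m * ?IB"
    using assms by (subst (asm) mult_le_cancel_left_pos) auto
  then have "(\<Sum>j<n. ?f j) / real n \<le> ?IA / pi + real m / real n * ?IB"
    using assms by (simp add: field_simps del: sum_distrib_left sum_distrib_right)
  also have "?IA / pi \<le> 2 + 2 / pi\<^sup>2 * ln (real b)"
    using integral_abs_cos_sum_le [OF assms(1)] by (simp add: field_simps)
  also have "real m / real n * ?IB
      \<le> real m / real n * (1 + (2 * real b + 1) * (1 + euler_mascheroni + ln (real b)))"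
    by (intro mult_left_mono integral_abs_cos_sum_deriv_le assms) auto
  finally show ?thesis by (simp add: h_def mult_ac)
qed

section \<open>The energy of a band circulant matrix\<close>

lemma mat_adjoint_dim [simp]:
  "dim_row (mat_adjoint A) = dim_col A" "dim_col (mat_adjoint A) = dim_row A"
  by (simp_all add: mat_adjoint_def)

lemma mat_adjoint_carrier [simp]: "A \<in> carrier_mat n m \<Longrightarrow> mat_adjoint A \<in> carrier_mat m n"
  by (intro carrier_matI) auto

lemma mat_adjoint_index:
  "i < dim_col A \<Longrightarrow> j < dim_row A \<Longrightarrow> mat_adjoint A $$ (i, j) = conjugate (A $$ (j, i))"
  by (simp add: mat_adjoint_def mat_of_rows_index)

lemma mult_carrier_mat_square [simp]:
  "A \<in> carrier_mat n n \<Longrightarrow> B \<in> carrier_mat n n \<Longrightarrow> A * B \<in> carrier_mat n n"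
  by (rule mult_carrier_mat)

lemma cscalar_prod_adjoint:
  fixes A :: "complex Matrix.mat"
  assumes "A \<in> carrier_mat n m" "v \<in> carrier_vec m" "w \<in> carrier_vec n"
  shows "(A *\<^sub>v v) \<bullet>c w = v \<bullet>c (mat_adjoint A *\<^sub>v w)"
proof -
  have "(A *\<^sub>v v) \<bullet>c w = (\<Sum>i<n. \<Sum>j<m. A $$ (i, j) * v $ j * conjugate (w $ i))"
    using assms by (simp add: scalar_prod_def sum_distrib_right atLeast0LessThan)
  also have "\<dots> = (\<Sum>j<m. \<Sum>i<n. A $$ (i, j) * v $ j * conjugate (w $ i))"
    by (rule sum.swap)
  also have "\<dots> = v \<bullet>c (mat_adjoint A *\<^sub>v w)"
    using assms
    by (simp add: scalar_prod_def sum_distrib_left atLeast0LessThan mat_adjoint_index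
        conjugate_complex_def cnj_sum ac_simps)
  finally show ?thesis .
qed

lemma mat_trace_mult_commute:
  assumes "A \<in> carrier_mat n m" "B \<in> carrier_mat m n"
  shows "mat_trace (A * B) = mat_trace (B * A)"
proof -
  have "mat_trace (A * B) = (\<Sum>i<n. \<Sum>j<m. A $$ (i, j) * B $$ (j, i))"
    using assms by (simp add: mat_trace_def scalar_prod_def atLeast0LessThan)
  also have "\<dots> = (\<Sum>j<m. \<Sum>i<n. A $$ (i, j) * B $$ (j, i))"
    by (rule sum.swap)
  also have "\<dots> = mat_trace (B * A)"
    using assms by (simp add: mat_trace_def scalar_prod_def atLeast0LessThan mult.commute)
  finally show ?thesis .
qed

text \<open>The entries come from real numbers, which makes the matrix self-adjoint, but its type is
  complex so that it can be conjugated by a complex unitary matrix.\<close>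

definition real_diag :: "nat \<Rightarrow> (nat \<Rightarrow> real) \<Rightarrow> complex Matrix.mat" where
  "real_diag n d = Matrix.mat n n (\<lambda>(i, j). if i = j then complex_of_real (d i) else 0)"

lemma real_diag_carrier [simp]: "real_diag n d \<in> carrier_mat n n"
  by (simp add: real_diag_def)

lemma real_diag_mult: "real_diag n d * real_diag n e = real_diag n (\<lambda>i. d i * e i)"
proof (rule eq_matI)
  fix i j assume "i < dim_row (real_diag n (\<lambda>i. d i * e i))" "j < dim_col (real_diag n (\<lambda>i. d i * e i))"
  then have ij: "i < n" "j < n" by (auto simp: real_diag_def)
  then have "(real_diag n d * real_diag n e) $$ (i, j)
      = (\<Sum>k<n. real_diag n d $$ (i, k) * real_diag n e $$ (k, j))"
    by (simp add: real_diag_def scalar_prod_def atLeast0LessThan)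
  also have "\<dots> = (\<Sum>k<n. if k = i then (if i = j then complex_of_real (d i * e i) else 0) else 0)"
    using ij by (intro sum.cong) (auto simp: real_diag_def)
  finally have "(real_diag n d * real_diag n e) $$ (i, j) = \<dots>" .
  with ij show "(real_diag n d * real_diag n e) $$ (i, j) = real_diag n (\<lambda>i. d i * e i) $$ (i, j)"
    by (simp add: real_diag_def)
qed (auto simp: real_diag_def)

lemma mat_adjoint_mult:
  fixes A B :: "complex Matrix.mat"
  assumes "A \<in> carrier_mat n m" "B \<in> carrier_mat m k"
  shows "mat_adjoint (A * B) = mat_adjoint B * mat_adjoint A"
proof (rule eq_matI)
  fix i j assume "i < dim_row (mat_adjoint B * mat_adjoint A)" "j < dim_col (mat_adjoint B * mat_adjoint A)"
  with assms have ij: "i < k" "j < n"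
    by auto
  with assms show "mat_adjoint (A * B) $$ (i, j) = (mat_adjoint B * mat_adjoint A) $$ (i, j)"
    by (simp add: mat_adjoint_index scalar_prod_def atLeast0LessThan cnj_sum conjugate_complex_def mult.commute)
qed (use assms in auto)

lemma mat_adjoint_adjoint: "mat_adjoint (mat_adjoint A) = A"
  by (rule eq_matI) (auto simp: mat_adjoint_index)

lemma mat_adjoint_real_diag: "mat_adjoint (real_diag n d) = real_diag n d"
  by (rule eq_matI) (auto simp: mat_adjoint_index real_diag_def conjugate_complex_def)

text \<open>The inner factors \<open>V * U\<close> cancel. This turns squaring
  \<open>U * D * V\<close> into squaring the diagonal matrix.\<close>

lemma mult_mat_assoc_middle:
  fixes U V D E W :: "complex Matrix.mat"
  assumes "U \<in> carrier_mat n n" "D \<in> carrier_mat n n" "V \<in> carrier_mat n n" "E \<in> carrier_mat n n"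
    and "V * U = 1\<^sub>m n"
  shows "U * D * V * (U * E * V) = U * (D * E) * V"
proof -
  have "U * D * V * (U * E * V) = U * D * (V * U) * E * V"
    using assms(1-4) by (simp add: assoc_mult_mat [of _ n n _ n _ n])
  then show ?thesis using assms by (simp add: assoc_mult_mat [of _ n n _ n _ n])
qed

section \<open>The energy of a unitarily diagonalised matrix\<close>

context
  fixes n :: nat and U V :: "complex Matrix.mat"
  assumes U: "U \<in> carrier_mat n n" and V_def: "V = mat_adjoint U" and VU: "V * U = 1\<^sub>m n"
begin

private lemma V: "V \<in> carrier_mat n n"
  using U by (simp add: V_def)

private lemma UV: "U * V = 1\<^sub>m n"
  using mat_mult_left_right_inverse [OF V U VU] .

private lemma adjoint_unitary_conj_real_diag:
  "mat_adjoint (U * real_diag n d * V) = U * real_diag n d * V"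
  using U V by (simp add: mat_adjoint_mult [of _ n n _ n] mat_adjoint_real_diag V_def mat_adjoint_adjoint
      assoc_mult_mat [of _ n n _ n _ n])

text \<open>In the coordinates \<open>w = V *\<^sub>v v\<close> the quadratic form becomes the sum
  of \<open>d i * (cmod (w $ i))\<^sup>2\<close>.\<close>

private lemma positive_semidefinite_unitary_conj_real_diag:
  assumes "\<And>i. i < n \<Longrightarrow> 0 \<le> d i"
  shows "positive_semidefinite (U * real_diag n d * V)"
proof -
  have "0 \<le> Re (((U * real_diag n d * V) *\<^sub>v v) \<bullet>c v)" if v: "v \<in> carrier_vec n" for v
  proof -
    define w where "w = V *\<^sub>v v"
    have w: "w \<in> carrier_vec n" using V v by (simp add: w_def)
    have "(U * real_diag n d * V) *\<^sub>v v = U *\<^sub>v (real_diag n d *\<^sub>v w)"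
      using U V v w by (simp add: assoc_mult_mat_vec [of _ n n _ n] w_def)
    then have "((U * real_diag n d * V) *\<^sub>v v) \<bullet>c v = (real_diag n d *\<^sub>v w) \<bullet>c w"
      using cscalar_prod_adjoint [OF U _ v, of "real_diag n d *\<^sub>v w"] w by (simp add: V_def w_def mult_mat_vec_carrier [of _ n n])
    also have "\<dots> = (\<Sum>i<n. complex_of_real (d i) * w $ i * cnj (w $ i))"
      using w by (simp add: scalar_prod_def real_diag_def atLeast0LessThan if_distrib [of "\<lambda>x. x * _"] sum.delta
          conjugate_complex_def cong: if_cong)
    also have "Re \<dots> = (\<Sum>i<n. d i * (cmod (w $ i))\<^sup>2)"
      by (simp add: mult.assoc complex_mult_cnj cmod_power2)
    also have "\<dots> \<ge> 0" using assms by (intro sum_nonneg) auto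
    finally show ?thesis .
  qed
  then show ?thesis
    using U V adjoint_unitary_conj_real_diag by (auto simp: positive_semidefinite_def)
qed

private lemma unitary_conj_real_diag_col:
  assumes "j < n"
  shows "(U * real_diag n d * V) *\<^sub>v col U j = complex_of_real (d j) \<cdot>\<^sub>v col U j"
proof -
  have "(U * real_diag n d * V) * U = U * real_diag n d"
    using U V VU by (simp add: assoc_mult_mat [of _ n n _ n _ n] right_mult_one_mat [of _ n n])
  then have "(U * real_diag n d * V) *\<^sub>v col U j = col (U * real_diag n d) j"
    using assms U V by (metis col_mult2 mult_carrier_mat real_diag_carrier)
  also have "\<dots> = complex_of_real (d j) \<cdot>\<^sub>v col U j"
    using assms U
    by (intro eq_vecI) (auto simp: scalar_prod_def real_diag_def atLeast0LessThan if_distrib [of "\<lambda>x. _ * x"] sum.delta mult.commute cong: if_cong)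
  finally show ?thesis .
qed

text \<open>A positive semidefinite root \<open>R\<close> of \<open>S\<^sup>2\<close> acts like \<open>S\<close> on every eigenvector \<open>f\<close> of \<open>S\<close>:
  for an eigenvalue \<open>s\<close>, the vector \<open>w = (R - s) f\<close> satisfies \<open>R w = - s w\<close>, which forces \<open>w = 0\<close>.\<close>
private lemma sqrt_unitary_conj_real_diag_unique:
  assumes d: "\<And>i. i < n \<Longrightarrow> 0 \<le> d i"
    and R: "R \<in> carrier_mat n n" "positive_semidefinite R"
    and RR: "R * R = U * real_diag n d * V * (U * real_diag n d * V)"
  shows "R = U * real_diag n d * V"
proof -
  define S where "S = U * real_diag n d * V"
  have S: "S \<in> carrier_mat n n" using U V by (simp add: S_def)
  have adjR: "mat_adjoint R = R" using R by (simp add: positive_semidefinite_def)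
  have "R *\<^sub>v col U j = S *\<^sub>v col U j" if j: "j < n" for j
  proof -
    define s where "s = complex_of_real (d j)"
    define f where "f = col U j"
    have f: "f \<in> carrier_vec n" using U by (auto simp: f_def intro!: carrier_vecI)
    have Sf: "S *\<^sub>v f = s \<cdot>\<^sub>v f"
      unfolding S_def f_def s_def using j by (rule unitary_conj_real_diag_col)
    define w where "w = R *\<^sub>v f - s \<cdot>\<^sub>v f"
    have w: "w \<in> carrier_vec n" using R f by (simp add: w_def)
    have RRf: "R *\<^sub>v (R *\<^sub>v f) = s * s \<cdot>\<^sub>v f"
    proof -
      have "R *\<^sub>v (R *\<^sub>v f) = S *\<^sub>v (S *\<^sub>v f)"
        using R S f RR by (metis S_def assoc_mult_mat_vec)
      then show ?thesis using S f Sf by (simp add: mult_mat_vec smult_smult_assoc)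
    qed
    have "w \<bullet>c w = 0"
    \<comment> \<open>For \<open>d j = 0\<close> the sign argument gives no information; instead
      \<open>w = R f\<close>, and self-adjointness turns its squared norm into the product of
      \<open>f\<close> with \<open>R (R f) = 0\<close>. For \<open>d j > 0\<close>, the quadratic
      form of \<open>R\<close> at \<open>w\<close> equals \<open>- d j\<close> times the squared
      norm of \<open>w\<close> and must be nonnegative.\<close>
    proof (cases "d j = 0")
      case True
      then have "w = R *\<^sub>v f" using R f by (auto simp: w_def s_def intro!: eq_vecI)
      then have "w \<bullet>c w = f \<bullet>c (R *\<^sub>v (R *\<^sub>v f))"
        using cscalar_prod_adjoint [OF R(1) f, of w] w by (simp add: adjR)
      also have "\<dots> = 0" using RRf True f by (simp add: s_def scalar_prod_def)
      finally show ?thesis .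
    next
      case False
      have Rw: "R *\<^sub>v w = - s \<cdot>\<^sub>v w"
        using R f RRf
        by (simp add: w_def mult_minus_distrib_mat_vec [of _ n n] mult_mat_vec [of _ n n])
           (intro eq_vecI, auto simp: algebra_simps)
      have "0 \<le> Re ((R *\<^sub>v w) \<bullet>c w)"
        using R w by (simp add: positive_semidefinite_def)
      also have "(R *\<^sub>v w) \<bullet>c w = - s * (w \<bullet>c w)"
        unfolding Rw using w by simp
      also have "Re \<dots> = - d j * Re (w \<bullet>c w)" by (simp add: s_def)
      finally have "Re (w \<bullet>c w) \<le> 0"
        using d [OF j] False by (simp add: mult_le_0_iff zero_le_mult_iff)
      with conjugate_square_ge_0_vec [of w] show ?thesis
        by (simp add: less_eq_complex_def complex_eq_iff)
    qed
    then have "w = 0\<^sub>v n" using w conjugate_square_eq_0_vec by blast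
    then have "R *\<^sub>v f - s \<cdot>\<^sub>v f = 0\<^sub>v n" by (simp add: w_def)
    then have "R *\<^sub>v f = s \<cdot>\<^sub>v f"
      using R f by (intro eq_vecI) (auto simp: vec_eq_iff)
    then show ?thesis by (simp add: Sf flip: f_def)
  qed
  \<comment> \<open>\<open>R\<close> and \<open>S\<close> agree on the columns of \<open>U\<close>;
    the invertibility of \<open>U\<close> then gives \<open>R = S\<close>.\<close>
  then have "R * U = S * U"
    using R S U by (intro mat_col_eqI) (simp_all only: col_mult2 [of _ n n _ n] index_mult_mat carrier_matD)
  then have "R * U * V = S * U * V" by simp
  then show ?thesis
    using R S U V UV by (simp add: assoc_mult_mat [of _ n n _ n _ n] S_def)
qed

text \<open>The square root of the product of adjoint and matrix is obtained by taking absolute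
  values on the diagonal. Its trace is invariant under the conjugation because traces are
  cyclic.\<close>

lemma matrix_energy_unitary_conj_real_diag:
  "matrix_energy (U * real_diag n d * V) = (\<Sum>i<n. \<bar>d i\<bar>)"
proof -
  let ?A = "U * real_diag n d * V" and ?S = "U * real_diag n (\<lambda>i. \<bar>d i\<bar>) * V"
  have sq: "mat_adjoint ?A * ?A = ?S * ?S"
    using U V VU
    by (simp add: adjoint_unitary_conj_real_diag mult_mat_assoc_middle [of _ n] real_diag_mult)
  have "mat_abs ?A = ?S"
    unfolding mat_abs_def
  \<comment> \<open>The description operator \<open>THE\<close> needs both parts: the candidate
    \<open>?S\<close> is a positive semidefinite root, and every such root equals it.\<close>
  proof (rule the_equality)
    show "?S \<in> carrier_mat (dim_col ?A) (dim_col ?A) \<and> positive_semidefinite ?S \<and> ?S * ?S = mat_adjoint ?A * ?A"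
      using U V sq positive_semidefinite_unitary_conj_real_diag by auto
  next
    fix R assume "R \<in> carrier_mat (dim_col ?A) (dim_col ?A) \<and> positive_semidefinite R \<and> R * R = mat_adjoint ?A * ?A"
    then show "R = ?S"
      using V by (intro sqrt_unitary_conj_real_diag_unique) (auto simp: sq)
  qed
  then have "matrix_energy ?A = Re (mat_trace (U * (real_diag n (\<lambda>i. \<bar>d i\<bar>) * V)))"
    using U V by (simp add: matrix_energy_def assoc_mult_mat [of _ n n _ n _ n])
  also have "mat_trace (U * (real_diag n (\<lambda>i. \<bar>d i\<bar>) * V)) = mat_trace (real_diag n (\<lambda>i. \<bar>d i\<bar>) * V * U)"
    using U V by (intro mat_trace_mult_commute [of _ n n]) auto
  also have "real_diag n (\<lambda>i. \<bar>d i\<bar>) * V * U = real_diag n (\<lambda>i. \<bar>d i\<bar>)"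
    using U V VU by (simp add: assoc_mult_mat [of _ n n _ n _ n] right_mult_one_mat [of _ n n])
  also have "Re (mat_trace (real_diag n (\<lambda>i. \<bar>d i\<bar>))) = (\<Sum>i<n. \<bar>d i\<bar>)"
    by (simp add: mat_trace_def real_diag_def)
  finally show ?thesis .
qed

end

section \<open>The discrete Fourier matrix and the spectrum of circulant matrices\<close>

lemma sum_cis_roots_of_unity:
  fixes m :: int
  assumes "n > 0"
  shows "(\<Sum>k<n. cis (2 * pi * real_of_int m * real k / real n)) = (if int n dvd m then of_nat n else 0)"
proof -
  \<comment> \<open>The sum is geometric in \<open>z\<close>. Since \<open>z ^ n = 1\<close>, it
    vanishes unless \<open>z = 1\<close>, which happens exactly when \<open>n\<close> divides
    \<open>m\<close>.\<close>
  define z where "z = cis (2 * pi * real_of_int m / real n)"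
  have pow: "cis (2 * pi * real_of_int m * real k / real n) = z ^ k" for k
    unfolding z_def Complex.DeMoivre by (intro arg_cong [of _ _ cis]) simp
  have z1: "z = 1 \<longleftrightarrow> int n dvd m"
  proof
    assume "z = 1"
    then have "cos (2 * pi * real_of_int m / real n) = 1" 
      by (simp add: z_def complex_eq_iff)
    then obtain i :: int where "2 * pi * real_of_int m / real n = real_of_int i * 2 * pi"
      using cos_one_2pi_int by blast
    then have "real_of_int m = real_of_int (i * int n)"
      using assms by (simp add: field_simps)
    then have "m = i * int n" using of_int_eq_iff by blast
    then show "int n dvd m" by simp
  next
    assume "int n dvd m"
    then obtain i where "m = int n * i" by blast
    then have "2 * pi * real_of_int m / real n = 2 * pi * real_of_int i" using assms by simp
    then show "z = 1" by (simp add: z_def cis_multiple_2pi)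
  qed
  have zn: "z ^ n = 1"
    using assms by (simp add: z_def Complex.DeMoivre cis_multiple_2pi)
  show ?thesis
  proof (cases "int n dvd m")
    case True
    with z1 have "z = 1" by simp
    then show ?thesis using True by (simp add: pow)
  next
    case False
    with z1 have "z \<noteq> 1" by simp
    then show ?thesis using False zn geometric_sum [of z n] by (simp add: pow)
  qed
qed

definition dft_mat :: "nat \<Rightarrow> complex Matrix.mat" where
  "dft_mat n = Matrix.mat n n (\<lambda>(i, j). cis (2 * pi * real i * real j / real n) / of_real (sqrt (real n)))"

lemma dft_mat_unitary:
  assumes "n > 0"
  shows "mat_adjoint (dft_mat n) * dft_mat n = 1\<^sub>m n"
proof (rule eq_matI)
  fix i j assume "i < dim_row (1\<^sub>m n)" "j < dim_col (1\<^sub>m n)"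
  then have ij: "i < n" "j < n" by auto
  have s: "of_real (sqrt (real n)) * of_real (sqrt (real n)) = (of_nat n :: complex)"
    by (simp flip: of_real_mult)
  \<comment> \<open>Both indices are below \<open>n\<close>, so their difference has absolute value
    less than \<open>n\<close>.\<close>
  have dvd: "int n dvd int j - int i \<longleftrightarrow> i = j"
    using ij zdvd_imp_le [of "int n" "\<bar>int j - int i\<bar>"] by (cases "i = j") auto
  have "(mat_adjoint (dft_mat n) * dft_mat n) $$ (i, j)
     = (\<Sum>k<n. cnj (dft_mat n $$ (k, i)) * dft_mat n $$ (k, j))"
    using ij by (simp add: scalar_prod_def atLeast0LessThan mat_adjoint_index conjugate_complex_def dft_mat_def)
  also have "\<dots> = (\<Sum>k<n. cis (2 * pi * real_of_int (int j - int i) * real k / real n)) / of_nat n"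
    unfolding sum_divide_distrib
    using ij s by (intro sum.cong)
      (auto simp: dft_mat_def cis_cnj cis_mult right_diff_distrib left_diff_distrib diff_divide_distrib mult_ac)
  also have "\<dots> = 1\<^sub>m n $$ (i, j)"
    using assms ij dvd by (simp add: sum_cis_roots_of_unity del: of_int_diff)
  finally show "(mat_adjoint (dft_mat n) * dft_mat n) $$ (i, j) = 1\<^sub>m n $$ (i, j)" .
qed (auto simp: dft_mat_def)

text \<open>The hypothesis says that the discrete Fourier transform of \<open>c\<close> takes the
  real values \<open>d\<close>. Entry \<open>(i, j)\<close> of the right side is the average over
  \<open>k\<close> of \<open>d k * cis (2 * pi * (i - j) * k / n)\<close>. Expanding
  \<open>d k\<close> and exchanging the sums leaves, by orthogonality of the characters, only the
  index \<open>l\<close> congruent to \<open>j - i\<close> modulo \<open>n\<close>.\<close>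

lemma circulant_eq_dft_conj:
  assumes d: "\<And>k. k < n \<Longrightarrow> (\<Sum>l<n. c l * cis (2 * pi * real k * real l / real n)) = complex_of_real (d k)"
  shows "circulant n c = dft_mat n * real_diag n d * mat_adjoint (dft_mat n)"
proof (rule eq_matI)
  fix i j assume "i < dim_row (dft_mat n * real_diag n d * mat_adjoint (dft_mat n))"
    "j < dim_col (dft_mat n * real_diag n d * mat_adjoint (dft_mat n))"
  then have ij: "i < n" "j < n" by (auto simp: dft_mat_def)
  then have n: "n > 0" by simp
  have s: "of_real (sqrt (real n)) * of_real (sqrt (real n)) = (of_nat n :: complex)"
    by (simp flip: of_real_mult)
  define l0 where "l0 = nat ((int j - int i) mod int n)"
  have l0: "l0 < n" "int l0 = (int j - int i) mod int n" using n by (auto simp: l0_def nat_less_iff)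
  have dvd: "int n dvd int l + int i - int j \<longleftrightarrow> l = l0" if "l < n" for l
  proof -
    have "int n dvd int l + int i - int j \<longleftrightarrow> int l mod int n = (int j - int i) mod int n"
      by (simp add: mod_eq_dvd_iff algebra_simps)
    also have "(int j - int i) mod int n = int l0" by (simp only: l0)
    finally show ?thesis using that by simp
  qed
  have UD: "(dft_mat n * real_diag n d) $$ (i, k) = dft_mat n $$ (i, k) * complex_of_real (d k)" if "k < n" for k
    using ij that
    by (simp add: scalar_prod_def atLeast0LessThan real_diag_def dft_mat_def if_distrib [of "\<lambda>x. _ * x"] sum.delta
        cong: if_cong)
  have "(dft_mat n * real_diag n d * mat_adjoint (dft_mat n)) $$ (i, j)
      = (\<Sum>k<n. (dft_mat n * real_diag n d) $$ (i, k) * cnj (dft_mat n $$ (j, k)))"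
    using ij by (subst index_mult_mat)
      (auto simp: scalar_prod_def atLeast0LessThan mat_adjoint_index conjugate_complex_def dft_mat_def real_diag_def)
  also have "\<dots> = (\<Sum>k<n. complex_of_real (d k) * cis (2 * pi * real_of_int (int i - int j) * real k / real n) / of_nat n)"
    using ij s by (intro sum.cong refl, subst UD)
      (auto simp: dft_mat_def cis_cnj cis_mult right_diff_distrib left_diff_distrib diff_divide_distrib mult_ac)
  also have "\<dots> = (\<Sum>k<n. \<Sum>l<n. c l * cis (2 * pi * real_of_int (int l + int i - int j) * real k / real n) / of_nat n)"
    by (intro sum.cong refl, subst d [symmetric])
       (auto simp: sum_distrib_right sum_divide_distrib cis_mult mult.assoc algebra_simps add_divide_distrib diff_divide_distrib intro!: sum.cong)
  also have "\<dots> = (\<Sum>l<n. \<Sum>k<n. c l * cis (2 * pi * real_of_int (int l + int i - int j) * real k / real n) / of_nat n)"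
    by (rule sum.swap)
  also have "\<dots> = (\<Sum>l<n. c l * (\<Sum>k<n. cis (2 * pi * real_of_int (int l + int i - int j) * real k / real n)) / of_nat n)"
    by (simp add: sum_distrib_left sum_divide_distrib)
  also have "\<dots> = (\<Sum>l<n. if l = l0 then c l else 0)"
    unfolding sum_cis_roots_of_unity [OF n]
    using n dvd by (intro sum.cong) auto
  also have "\<dots> = c l0" using l0 by simp
  finally show "circulant n c $$ (i, j) = (dft_mat n * real_diag n d * mat_adjoint (dft_mat n)) $$ (i, j)"
    using ij by (simp add: circulant_def l0_def)
qed (auto simp: circulant_def dft_mat_def)

definition circulant_eigenvalue :: "nat \<Rightarrow> nat \<Rightarrow> (nat \<Rightarrow> real) \<Rightarrow> nat \<Rightarrow> real" where
  "circulant_eigenvalue n b x j = 2 * (\<Sum>k=1..b. x k * cos (2 * pi * real j * real k / real n))"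

text \<open>The terms at \<open>l\<close> and \<open>n - l\<close> carry the same coefficient and
  conjugate exponentials, so they combine to twice a cosine. Hence the eigenvalues are real.\<close>

lemma sum_band_tuple:
  assumes "2 * b < n"
  shows "(\<Sum>l<n. band_tuple n b x l * cis (2 * pi * real k * real l / real n))
           = complex_of_real (circulant_eigenvalue n b x k)"
proof -
  let ?e = "\<lambda>l. cis (2 * pi * real k * real l / real n)"
  let ?g = "\<lambda>l. band_tuple n b x l * ?e l"
  have "(\<Sum>l<n. ?g l) = (\<Sum>l\<in>{1..b} \<union> {n - b..<n}. ?g l)"
    using assms by (intro sum.mono_neutral_right) (auto simp: band_tuple_def)
  \<comment> \<open>The condition \<open>2 * b < n\<close> keeps the two bands disjoint.\<close>
  also have "\<dots> = (\<Sum>l=1..b. ?g l) + (\<Sum>l=n - b..<n. ?g l)"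
    using assms by (intro sum.union_disjoint) auto
  also have "(\<Sum>l=n - b..<n. ?g l) = (\<Sum>l=1..b. ?g (n - l))"
    using assms by (intro sum.reindex_bij_witness [of _ "\<lambda>l. n - l" "\<lambda>l. n - l"]) auto
  also have "(\<Sum>l=1..b. ?g l) + (\<Sum>l=1..b. ?g (n - l))
      = (\<Sum>l=1..b. complex_of_real (x l) * (?e l + cis (- (2 * pi * real k * real l / real n))))"
    unfolding sum.distrib [symmetric]
  proof (rule sum.cong [OF refl])
    fix l assume l: "l \<in> {1..b}"
    have band: "band_tuple n b x l = complex_of_real (x l)" "band_tuple n b x (n - l) = complex_of_real (x l)"
      using l assms by (auto simp: band_tuple_def)
    have "2 * pi * real k * real (n - l) / real n = 2 * pi * real k - 2 * pi * real k * real l / real n"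
      using l assms by (simp add: of_nat_diff field_simps)
    then have "?e (n - l) = cis (2 * pi * real k) * cis (- (2 * pi * real k * real l / real n))"
      by (simp only: cis_mult) simp
    also have "cis (2 * pi * real k) = 1"
      using cis_multiple_2pi [of "real k"] by simp
    finally show "?g l + ?g (n - l) = complex_of_real (x l) * (?e l + cis (- (2 * pi * real k * real l / real n)))"
      using band by (simp add: distrib_left)
  qed
  also have "\<dots> = complex_of_real (circulant_eigenvalue n b x k)"
    by (simp add: circulant_eigenvalue_def sum_distrib_left complex_eq_iff mult_ac)
  finally show ?thesis .
qed

lemma matrix_energy_band_circulant:
  assumes "2 * b < n"
  shows "matrix_energy (band_circulant n b x) = (\<Sum>j<n. \<bar>circulant_eigenvalue n b x j\<bar>)"
proof -
  have "band_circulant n b x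
      = dft_mat n * real_diag n (circulant_eigenvalue n b x) * mat_adjoint (dft_mat n)"
    unfolding band_circulant_def by (intro circulant_eq_dft_conj sum_band_tuple assms)
  moreover have "dft_mat n \<in> carrier_mat n n" by (simp add: dft_mat_def)
  ultimately show ?thesis
    using assms by (simp add: matrix_energy_unitary_conj_real_diag dft_mat_unitary)
qed

section \<open>Absolute moments via the Berry--Esseen inequality\<close>

text \<open>Independence means that the joint law is the product of the marginal laws. Under
  \<open>N\<close>, the joint law of the coordinates is \<open>N\<close> itself and their marginals
  are the laws of the \<open>X i\<close>, so this property carries over.\<close>

lemma prob_space_PiM_coordinates:
  assumes "prob_space M" "I \<noteq> {}" and X: "\<And>i. i \<in> I \<Longrightarrow> X i \<in> borel_measurable M"
    and ind: "prob_space.indep_vars M (\<lambda>_. borel) X I"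
  defines "N \<equiv> distr M (\<Pi>\<^sub>M i\<in>I. borel) (\<lambda>\<omega>. \<lambda>i\<in>I. X i \<omega>)"
  shows "prob_space N" "prob_space.indep_vars N (\<lambda>_. borel) (\<lambda>i \<omega>. \<omega> i) I"
proof -
  interpret M: prob_space M by fact
  have meas: "(\<lambda>\<omega>. \<lambda>i\<in>I. X i \<omega>) \<in> measurable M (\<Pi>\<^sub>M i\<in>I. borel)"
    by (intro measurable_restrict X)
  show N: "prob_space N" unfolding N_def by (rule M.prob_space_distr) fact
  interpret N: prob_space N by fact
  have coord: "(\<lambda>\<omega>. \<omega> i) \<in> borel_measurable N" if "i \<in> I" for i
    using that unfolding N_def by simp
  have "distr N (\<Pi>\<^sub>M i\<in>I. borel) (\<lambda>\<omega>. \<lambda>i\<in>I. \<omega> i) = distr N (\<Pi>\<^sub>M i\<in>I. borel) (\<lambda>\<omega>. \<omega>)"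
    by (intro distr_cong) (auto simp: N_def space_PiM PiE_restrict)
  also have "\<dots> = N" by (rule distr_id2) (simp add: N_def)
  also have "\<dots> = (\<Pi>\<^sub>M i\<in>I. distr M borel (X i))"
    using ind M.indep_vars_iff_distr_eq_PiM' [OF \<open>I \<noteq> {}\<close>, where M' = "\<lambda>_. borel" and X = X] X by (simp add: N_def)
  also have "\<dots> = (\<Pi>\<^sub>M i\<in>I. distr N borel (\<lambda>\<omega>. \<omega> i))"
  proof (rule PiM_cong [OF refl])
    fix i assume i: "i \<in> I"
    have "distr N borel (\<lambda>\<omega>. \<omega> i) = distr M borel ((\<lambda>\<omega>. \<omega> i) \<circ> (\<lambda>\<omega>. \<lambda>i\<in>I. X i \<omega>))"
      unfolding N_def using meas i by (intro distr_distr) auto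
    then show "distr M borel (X i) = distr N borel (\<lambda>\<omega>. \<omega> i)" using i by (simp add: comp_def)
  qed
  finally show "N.indep_vars (\<lambda>_. borel) (\<lambda>i \<omega>. \<omega> i) I"
    using N.indep_vars_iff_distr_eq_PiM' [OF \<open>I \<noteq> {}\<close>, where M' = "\<lambda>_. borel" and X = "\<lambda>i \<omega>. \<omega> i"] coord by simp
qed

text \<open>The predicate \<open>nonuniform_berry_esseen\<close> quantifies over measures on
  \<open>nat \<Rightarrow> real\<close> only. It is applied to the joint law \<open>N\<close> of the
  variables with the coordinates as random variables; all probabilities and moments involved agree
  with those under \<open>M\<close>.\<close>

lemma nonuniform_berry_esseenD:
  fixes M :: "'a measure" and X :: "nat \<Rightarrow> 'a \<Rightarrow> real"
  assumes "nonuniform_berry_esseen C" "prob_space M"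
    and ind: "prob_space.indep_vars M (\<lambda>_. borel) X {1..b}"
    and int: "\<And>k. k \<in> {1..b} \<Longrightarrow> integrable M (\<lambda>\<omega>. \<bar>X k \<omega>\<bar> ^ 3)"
    and mean: "\<And>k. k \<in> {1..b} \<Longrightarrow> integral\<^sup>L M (X k) = 0"
    and B: "B = (\<Sum>k=1..b. \<integral>\<omega>. \<bar>X k \<omega>\<bar>\<^sup>2 \<partial>M)" "0 < B"
  shows "\<bar>measure M {\<omega> \<in> space M. (1 / sqrt B) * (\<Sum>k=1..b. X k \<omega>) \<le> x} - cdf std_normal_distribution x\<bar>
            \<le> C * ((\<Sum>k=1..b. \<integral>\<omega>. \<bar>X k \<omega>\<bar> ^ 3 \<partial>M) / B powr (3/2)) * (1 / (1 + \<bar>x\<bar> ^ 3))"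
proof -
  interpret M: prob_space M by fact
  define I where "I = {1..b}"
  \<comment> \<open>The empty sum is excluded by \<open>0 < B\<close>; the product characterisation
    of independence requires a nonempty index set.\<close>
  have I: "I \<noteq> {}" using B by (cases "b = 0") (auto simp: I_def)
  have X: "X k \<in> borel_measurable M" if "k \<in> I" for k
    using that ind unfolding M.indep_vars_def I_def by auto
  have meas: "(\<lambda>\<omega>. \<lambda>i\<in>I. X i \<omega>) \<in> measurable M (\<Pi>\<^sub>M i\<in>I. borel)"
    by (intro measurable_restrict X)
  define N where "N = distr M (\<Pi>\<^sub>M i\<in>I. borel) (\<lambda>\<omega>. \<lambda>i\<in>I. X i \<omega>)"
  note N = prob_space_PiM_coordinates [OF \<open>prob_space M\<close> I X ind [folded I_def], folded N_def]
  have int_eq: "integral\<^sup>L N (\<lambda>\<omega>. g (\<omega> k)) = integral\<^sup>L M (\<lambda>\<omega>. g (X k \<omega>))"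
    if "k \<in> I" "g \<in> borel_measurable borel" for g :: "real \<Rightarrow> real" and k
    unfolding N_def using that meas by (subst integral_distr) auto
  have integrable_N: "integrable N (\<lambda>\<omega>. \<bar>\<omega> k\<bar> ^ 3)" if "k \<in> I" for k
    unfolding N_def using that meas int by (subst integrable_distr_eq) (auto simp: I_def)
  have "measure N {\<omega> \<in> space N. (1 / sqrt B) * (\<Sum>k\<in>I. \<omega> k) \<le> x}
      = measure M {\<omega> \<in> space M. (1 / sqrt B) * (\<Sum>k\<in>I. X k \<omega>) \<le> x}"
  proof -
    have "{\<omega> \<in> space (\<Pi>\<^sub>M i\<in>I. borel). (1 / sqrt B) * (\<Sum>k\<in>I. \<omega> k) \<le> x} \<in> sets (\<Pi>\<^sub>M i\<in>I. (borel :: real measure))"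
      by measurable
    then have "measure N {\<omega> \<in> space N. (1 / sqrt B) * (\<Sum>k\<in>I. \<omega> k) \<le> x}
      = measure M ((\<lambda>\<omega>. \<lambda>i\<in>I. X i \<omega>) -` {\<omega> \<in> space (\<Pi>\<^sub>M i\<in>I. borel). (1 / sqrt B) * (\<Sum>k\<in>I. \<omega> k) \<le> x} \<inter> space M)"
      unfolding N_def space_distr using meas by (intro measure_distr) auto
    also have "(\<lambda>\<omega>. \<lambda>i\<in>I. X i \<omega>) -` {\<omega> \<in> space (\<Pi>\<^sub>M i\<in>I. borel). (1 / sqrt B) * (\<Sum>k\<in>I. \<omega> k) \<le> x} \<inter> space M
      = {\<omega> \<in> space M. (1 / sqrt B) * (\<Sum>k\<in>I. X k \<omega>) \<le> x}"
      using measurable_space [OF meas] by auto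
    finally show ?thesis .
  qed
  moreover have "\<bar>measure N {\<omega> \<in> space N. (1 / sqrt B) * (\<Sum>k=1..b. \<omega> k) \<le> x} - cdf std_normal_distribution x\<bar>
            \<le> C * ((\<Sum>k=1..b. \<integral>\<omega>. \<bar>\<omega> k\<bar> ^ 3 \<partial>N) / B powr (3/2)) * (1 / (1 + \<bar>x\<bar> ^ 3))"
  proof -
    have BN: "(\<Sum>k=1..b. \<integral>\<omega>. \<bar>\<omega> k\<bar>\<^sup>2 \<partial>N) = B"
      unfolding B I_def [symmetric] by (intro sum.cong int_eq refl) auto
    have mean_N: "integral\<^sup>L N (\<lambda>\<omega>. \<omega> k) = 0" if "k \<in> {1..b}" for k
      using int_eq [of k "\<lambda>x. x"] mean that by (simp add: I_def)
    show ?thesis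
      using assms(1) [unfolded nonuniform_berry_esseen_def Let_def, rule_format, of N "\<lambda>k \<omega>. \<omega> k" b x]
        N mean_N integrable_N B BN by (simp add: I_def)
  qed
  moreover have "(\<Sum>k\<in>I. \<integral>\<omega>. \<bar>\<omega> k\<bar> ^ 3 \<partial>N) = (\<Sum>k\<in>I. \<integral>\<omega>. \<bar>X k \<omega>\<bar> ^ 3 \<partial>M)"
    by (intro sum.cong refl int_eq) auto
  ultimately show ?thesis by (simp add: I_def)
qed

lemma (in real_distribution) integral_abs_eq_cdf:
  assumes "integrable M (\<lambda>x. \<bar>x\<bar>)"
  shows "has_bochner_integral lborel (\<lambda>x. \<bar>cdf M x - indicator {0..} x\<bar>) (\<integral>x. \<bar>x\<bar> \<partial>M)"
proof -
  interpret L: sigma_finite_measure "lborel :: real measure" by (rule sigma_finite_lborel)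
  interpret P: pair_sigma_finite M lborel ..
  \<comment> \<open>For fixed \<open>y\<close>, the function \<open>?A y\<close> indicates the
    points between \<open>0\<close> and \<open>y\<close>, a set of length
    \<open>\<bar>y\<bar>\<close>. For fixed \<open>x\<close>, its mean over \<open>y\<close> is the
    probability of \<open>y \<le> x\<close> if \<open>x < 0\<close>, and of \<open>y > x\<close>
    otherwise. Integrating in both orders proves the claim.\<close>
  let ?A = "\<lambda>y x. indicator {y..<0} x + indicator {0..<y} x :: ennreal"
  have [measurable_cong]: "sets M = sets borel" by (rule events_eq_borel)
  have "(\<lambda>(y, x). if y \<le> x \<and> x < 0 \<or> 0 \<le> x \<and> x < y then 1 else 0 :: ennreal) \<in> borel_measurable (M \<Otimes>\<^sub>M lborel)"
    by measurable
  also have "(\<lambda>(y :: real, x :: real). if y \<le> x \<and> x < 0 \<or> 0 \<le> x \<and> x < y then 1 else 0 :: ennreal) = (\<lambda>(y, x). ?A y x)"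
    by (auto simp: fun_eq_iff indicator_def)
  finally have meas: "(\<lambda>(y, x). ?A y x) \<in> borel_measurable (M \<Otimes>\<^sub>M lborel)" .
  have "(\<integral>\<^sup>+x. ennreal \<bar>cdf M x - indicator {0..} x\<bar> \<partial>lborel) = (\<integral>\<^sup>+x. (\<integral>\<^sup>+y. ?A y x \<partial>M) \<partial>lborel)"
  proof (rule nn_integral_cong)
    fix x :: real
    show "ennreal \<bar>cdf M x - indicator {0..} x\<bar> = (\<integral>\<^sup>+y. ?A y x \<partial>M)"
    proof (cases "x < 0")
      case True
      then have "(\<integral>\<^sup>+y. ?A y x \<partial>M) = (\<integral>\<^sup>+y. indicator {..x} y \<partial>M)"
        by (intro nn_integral_cong) (auto simp: indicator_def)
      also have "\<dots> = emeasure M {..x}" by simp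
      finally show ?thesis using True by (simp add: cdf_def emeasure_eq_measure)
    next
      case False
      then have "(\<integral>\<^sup>+y. ?A y x \<partial>M) = (\<integral>\<^sup>+y. indicator {x<..} y \<partial>M)"
        by (intro nn_integral_cong) (auto simp: indicator_def)
      also have "\<dots> = emeasure M {x<..}" by simp
      also have "\<dots> = ennreal (1 - cdf M x)"
      proof -
        have "prob (space M - {..x}) = 1 - prob {..x}" by (rule prob_compl) simp
        moreover have "space M - {..x} = {x<..}" by auto
        ultimately show ?thesis by (simp add: cdf_def emeasure_eq_measure)
      qed
      finally show ?thesis using False cdf_bounded_prob [of x] by (simp add: abs_if)
    qed
  qed
  also have "\<dots> = (\<integral>\<^sup>+y. (\<integral>\<^sup>+x. ?A y x \<partial>lborel) \<partial>M)"
    using P.Fubini' [OF meas] by simp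
  also have "\<dots> = (\<integral>\<^sup>+y. ennreal \<bar>y\<bar> \<partial>M)"
    by (intro nn_integral_cong, subst nn_integral_add)
       (auto simp: abs_if emeasure_lborel_Ico)
  also have "\<dots> = ennreal (\<integral>x. \<bar>x\<bar> \<partial>M)"
    using assms by (intro nn_integral_eq_integral) auto
  finally have eq: "(\<integral>\<^sup>+x. ennreal \<bar>cdf M x - indicator {0..} x\<bar> \<partial>lborel) = ennreal (\<integral>x. \<bar>x\<bar> \<partial>M)" .
  have "cdf M \<in> borel_measurable borel"
    using cdf_nondecreasing by (intro borel_measurable_mono monoI)
  with eq show ?thesis
    by (intro has_bochner_integral_nn_integral) auto
qed

lemma has_bochner_integral_one_over_one_plus_abs_cube:
  "has_bochner_integral lborel (\<lambda>x::real. 1 / (1 + \<bar>x\<bar> ^ 3)) (4 * pi / (3 * sqrt 3))"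
proof -
  let ?f = "\<lambda>x::real. 1 / (1 + \<bar>x\<bar> ^ 3)"
  \<comment> \<open>An antiderivative on the nonnegative half-line, found by partial fractions from
    \<open>1 + x ^ 3 = (1 + x) * (x\<^sup>2 - x + 1)\<close>. The logarithms cancel at infinity and
    vanish at \<open>0\<close>, so only the arctangent contributes: \<open>pi / 2 / sqrt 3\<close>
    at infinity and \<open>- pi / (6 * sqrt 3)\<close> at \<open>0\<close>. Evenness doubles the
    result.\<close>
  define F where "F = (\<lambda>x::real. ln (1 + x) / 3 - ln (x\<^sup>2 - x + 1) / 6 + arctan ((2 * x - 1) / sqrt 3) / sqrt 3)"
  have q: "x\<^sup>2 - x + 1 > 0" for x :: real
  proof -
    have "x\<^sup>2 - x + 1 = (x - 1/2)\<^sup>2 + 3/4" by (simp add: power2_eq_square field_simps)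
    then show ?thesis by (simp add: add_nonneg_pos)
  qed
  have "(\<integral>\<^sup>+x. ennreal (?f x) * indicator {0..} x \<partial>lborel) = ennreal (pi / 2 / sqrt 3 - F 0)"
  proof (rule nn_integral_FTC_atLeast)
    show "(F has_real_derivative ?f x) (at x)" if "0 \<le> x" for x
    proof -
      have cube: "1 + x ^ 3 = (1 + x) * (x\<^sup>2 - x + 1)"
        by (simp add: power2_eq_square power3_eq_cube algebra_simps)
      have at: "1 + ((2 * x - 1) / sqrt 3)\<^sup>2 = 4 * (x\<^sup>2 - x + 1) / 3"
        by (simp add: power_divide) (simp add: power2_eq_square field_simps)
      have "(F has_real_derivative (1 / (1 + x)) / 3 - ((2 * x - 1) / (x\<^sup>2 - x + 1)) / 6
          + inverse (1 + ((2 * x - 1) / sqrt 3)\<^sup>2) * (2 / sqrt 3) / sqrt 3) (at x)"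
        unfolding F_def
      proof (intro DERIV_add DERIV_diff DERIV_cdivide)
        show "((\<lambda>x. ln (1 + x)) has_real_derivative 1 / (1 + x)) (at x)"
          using that by (auto intro!: derivative_eq_intros)
        show "((\<lambda>x. ln (x\<^sup>2 - x + 1)) has_real_derivative (2 * x - 1) / (x\<^sup>2 - x + 1)) (at x)"
          using q [of x] by (auto intro!: derivative_eq_intros)
        show "((\<lambda>x. arctan ((2 * x - 1) / sqrt 3)) has_real_derivative
            inverse (1 + ((2 * x - 1) / sqrt 3)\<^sup>2) * (2 / sqrt 3)) (at x)"
        proof (rule DERIV_chain2 [OF DERIV_arctan])
          have "((\<lambda>x. 2 * x - 1) has_real_derivative 2) (at x)"
            by (auto intro!: derivative_eq_intros)
          then show "((\<lambda>x. (2 * x - 1) / sqrt 3) has_real_derivative 2 / sqrt 3) (at x)"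
            by (rule DERIV_cdivide)
        qed
      qed
      also have "inverse (1 + ((2 * x - 1) / sqrt 3)\<^sup>2) * (2 / sqrt 3) / sqrt 3 = 1 / (2 * (x\<^sup>2 - x + 1))"
      proof -
        define v where "v = x\<^sup>2 - x + 1"
        have v: "v > 0" using q [of x] by (simp add: v_def)
        have "2 / sqrt 3 / sqrt 3 = (2 / 3 :: real)" by simp
        then have "inverse (4 * v / 3) * (2 / sqrt 3) / sqrt 3 = inverse (4 * v / 3) * (2 / 3)"
          by (metis times_divide_eq_right)
        also have "\<dots> = 1 / (2 * v)" using v by (simp add: field_simps)
        finally show ?thesis unfolding at v_def .
      qed
      also have "(1 / (1 + x)) / 3 - ((2 * x - 1) / (x\<^sup>2 - x + 1)) / 6 + 1 / (2 * (x\<^sup>2 - x + 1)) = 1 / ((1 + x) * (x\<^sup>2 - x + 1))"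
      proof -
        define u where "u = 1 + x" define v where "v = x\<^sup>2 - x + 1"
        have nz: "u \<noteq> 0" "v \<noteq> 0" using that q [of x] by (auto simp: u_def v_def)
        have "(1 / u) / 3 - ((2 * x - 1) / v) / 6 + 1 / (2 * v) = (2 * v - (2 * x - 1) * u + 3 * u) / (6 * u * v)"
          using nz by (simp add: field_simps)
        also have "2 * v - (2 * x - 1) * u + 3 * u = 6"
          by (simp add: u_def v_def power2_eq_square algebra_simps)
        also have "6 / (6 * u * v) = 1 / (u * v)" by simp
        finally show ?thesis unfolding u_def v_def .
      qed
      finally show ?thesis using that by (simp add: cube)
    qed
    show "(F \<longlongrightarrow> pi / 2 / sqrt 3) at_top"
    proof -
      have "((\<lambda>x::real. ln (1 + x) / 3 - ln (x\<^sup>2 - x + 1) / 6) \<longlongrightarrow> 0) at_top"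
        by real_asymp
      moreover have "((\<lambda>x::real. arctan ((2 * x - 1) / sqrt 3) / sqrt 3) \<longlongrightarrow> pi / 2 / sqrt 3) at_top"
        by (intro tendsto_divide tendsto_const filterlim_compose [OF tendsto_arctan_at_top]) (real_asymp, simp)
      ultimately show ?thesis unfolding F_def using tendsto_add by fastforce
    qed
  qed auto
  also have "F 0 = - (pi / (6 * sqrt 3))"
  proof -
    have "arctan ((2 * 0 - 1) / sqrt 3) = - (pi / 6)"
    proof (rule arctan_unique)
      show "- (pi / 2) < - (pi / 6)" "- (pi / 6) < pi / 2" using pi_gt_zero by linarith+
      show "tan (- (pi / 6)) = (2 * 0 - 1) / sqrt 3" by (simp add: tan_30)
    qed
    then have "F 0 = - (pi / 6) / sqrt 3" unfolding F_def by (simp only:) simp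
    then show ?thesis by simp
  qed
  also have "pi / 2 / sqrt 3 - - (pi / (6 * sqrt 3)) = 2 * pi / (3 * sqrt 3)"
    by (simp add: field_simps)
  also have "(\<integral>\<^sup>+x. ennreal (?f x) * indicator {0..} x \<partial>lborel) = (\<integral>\<^sup>+x. ennreal (indicator {0..} x *\<^sub>R ?f x) \<partial>lborel)"
    by (intro nn_integral_cong) (auto simp: indicator_def)
  finally have "has_bochner_integral lborel (\<lambda>x. indicator {0..} x *\<^sub>R ?f x) (2 * pi / (3 * sqrt 3))"
    by (intro has_bochner_integral_nn_integral) (auto simp: indicator_def)
  from has_bochner_integral_even_function [OF this] show ?thesis by simp
qed

lemma std_normal_abs_moment:
  "integrable std_normal_distribution (\<lambda>x. \<bar>x\<bar>)" "(\<integral>x. \<bar>x\<bar> \<partial>std_normal_distribution) = sqrt (2 / pi)"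
proof -
  show "integrable std_normal_distribution (\<lambda>x. \<bar>x\<bar>)"
    using integrable_std_normal_distribution_moment [of 1] by (auto intro: integrable_abs)
  show "(\<integral>x. \<bar>x\<bar> \<partial>std_normal_distribution) = sqrt (2 / pi)"
    using std_normal_distribution_odd_moments_abs [of 0] by simp
qed

text \<open>Both absolute moments are integrals of distances from a distribution function to the
  unit step at \<open>0\<close>. By the reverse triangle inequality, their difference is at most the
  integral of the distance between the two distribution functions.\<close>

lemma abs_moment_diff_std_normal_le:
  assumes "real_distribution P" "integrable P (\<lambda>x. \<bar>x\<bar>)"
    and le: "\<And>x. \<bar>cdf P x - cdf std_normal_distribution x\<bar> \<le> K * (1 / (1 + \<bar>x\<bar> ^ 3))"
  shows "\<bar>(\<integral>x. \<bar>x\<bar> \<partial>P) - sqrt (2 / pi)\<bar> \<le> K * (4 * pi / (3 * sqrt 3))"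
proof -
  let ?Q = std_normal_distribution
  interpret P: real_distribution P by fact
  interpret Q: real_distribution ?Q by (rule real_dist_normal_dist)
  let ?p = "\<lambda>x. \<bar>cdf P x - indicator {0..} x\<bar>" and ?q = "\<lambda>x. \<bar>cdf ?Q x - indicator {0..} x\<bar>"
  have p: "has_bochner_integral lborel ?p (\<integral>x. \<bar>x\<bar> \<partial>P)"
    by (rule P.integral_abs_eq_cdf) fact
  have q: "has_bochner_integral lborel ?q (sqrt (2 / pi))"
    using Q.integral_abs_eq_cdf std_normal_abs_moment by simp
  have r: "has_bochner_integral lborel (\<lambda>x. K * (1 / (1 + \<bar>x\<bar> ^ 3))) (K * (4 * pi / (3 * sqrt 3)))"
    by (intro has_bochner_integral_mult_right has_bochner_integral_one_over_one_plus_abs_cube)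
  have pq: "has_bochner_integral lborel (\<lambda>x. ?p x - ?q x) ((\<integral>x. \<bar>x\<bar> \<partial>P) - sqrt (2 / pi))"
    using p q by (rule has_bochner_integral_diff)
  have "\<bar>\<integral>x. ?p x - ?q x \<partial>lborel\<bar> \<le> (\<integral>x. K * (1 / (1 + \<bar>x\<bar> ^ 3)) \<partial>lborel)"
  proof -
    have "\<bar>\<integral>x. ?p x - ?q x \<partial>lborel\<bar> \<le> (\<integral>x. \<bar>?p x - ?q x\<bar> \<partial>lborel)"
      by (rule integral_abs_bound)
    also have "\<dots> \<le> (\<integral>x. K * (1 / (1 + \<bar>x\<bar> ^ 3)) \<partial>lborel)"
    proof (rule integral_mono)
      show "integrable lborel (\<lambda>x. \<bar>?p x - ?q x\<bar>)" "integrable lborel (\<lambda>x. K * (1 / (1 + \<bar>x\<bar> ^ 3)))"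
        using pq r by (auto simp: has_bochner_integral_iff intro: integrable_abs)
      show "\<bar>?p x - ?q x\<bar> \<le> K * (1 / (1 + \<bar>x\<bar> ^ 3))" for x
        using le [of x] by linarith
    qed
    finally show ?thesis .
  qed
  then show ?thesis
    using pq r by (simp add: has_bochner_integral_iff)
qed

text \<open>A single standard normal variable and \<open>x = 0\<close> are a valid instance, in
  which \<open>C\<close> times a positive number bounds an absolute value. The sign is needed to
  multiply inequalities by \<open>C\<close>.\<close>

lemma nonuniform_berry_esseen_nonneg:
  assumes "nonuniform_berry_esseen C"
  shows "C \<ge> 0"
proof -
  let ?M = std_normal_distribution
  interpret M: real_distribution ?M by (rule real_dist_normal_dist)
  have ind: "M.indep_vars (\<lambda>_. borel) (\<lambda>k x. x) {1..1::nat}"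
  proof -
    have "{(\<lambda>x. x) -` A \<inter> space ?M |A. A \<in> sets borel} \<subseteq> M.events" by auto
    then show ?thesis
      unfolding M.indep_vars_def2 M.indep_sets_def
      by (auto simp: subset_singleton_iff Pi_iff)
  qed
  have m1: "integral\<^sup>L ?M (\<lambda>x. x) = 0"
    using integral_std_normal_distribution_moment_odd [of 1] by simp
  have m2: "(\<integral>x. \<bar>x\<bar>\<^sup>2 \<partial>?M) = 1"
    using std_normal_distribution_even_moments_abs [of 1] by simp
  have m3: "(\<integral>x. \<bar>x\<bar> ^ 3 \<partial>?M) = sqrt (2 / pi) * 2"
    using std_normal_distribution_odd_moments_abs [of 1] by (simp add: numeral_3_eq_3)
  have "integrable ?M (\<lambda>x. \<bar>x\<bar> ^ 3)"
    using integrable_std_normal_distribution_moment [of 3] by (auto dest: integrable_abs simp: power_abs)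
  then have "0 \<le> C * (sqrt (2 / pi) * 2)"
    using nonuniform_berry_esseenD [OF assms M.prob_space_axioms ind, of 1 0] m1 m2 m3
    by simp
  moreover have "sqrt (2 / pi) * 2 > 0" by simp
  ultimately show ?thesis by (meson mult_neg_pos not_le)
qed

text \<open>The weighted variables \<open>c k * \<eta> k\<close> are independent but have different
  laws in general. The Berry--Esseen bound is applied to their normalised sum and then multiplied by
  its standard deviation \<open>sqrt B\<close>; the weights drop out of the final error.\<close>

lemma (in prob_space) weighted_sum_abs_moment:
  fixes \<eta> :: "nat \<Rightarrow> 'a \<Rightarrow> real" and c :: "nat \<Rightarrow> real"
  assumes C: "nonuniform_berry_esseen C"
    and ind: "indep_vars (\<lambda>_. borel) \<eta> {1..b}"
    and int: "\<And>k. k \<in> {1..b} \<Longrightarrow> integrable M (\<eta> k)"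
    and int3: "\<And>k. k \<in> {1..b} \<Longrightarrow> integrable M (\<lambda>\<omega>. \<bar>\<eta> k \<omega>\<bar> ^ 3)"
    and mean: "\<And>k. k \<in> {1..b} \<Longrightarrow> expectation (\<eta> k) = 0"
    and var: "\<And>k. k \<in> {1..b} \<Longrightarrow> expectation (\<lambda>\<omega>. \<bar>\<eta> k \<omega>\<bar>\<^sup>2) = \<sigma>\<^sup>2"
    and third: "\<And>k. k \<in> {1..b} \<Longrightarrow> expectation (\<lambda>\<omega>. \<bar>\<eta> k \<omega>\<bar> ^ 3) = \<mu>"
    and \<sigma>: "\<sigma> > 0" and \<mu>: "\<mu> \<ge> 0"
    and c: "\<And>k. k \<in> {1..b} \<Longrightarrow> \<bar>c k\<bar> \<le> 1"
  shows "\<bar>expectation (\<lambda>\<omega>. \<bar>\<Sum>k=1..b. c k * \<eta> k \<omega>\<bar>) - \<sigma> * sqrt (\<Sum>k=1..b. (c k)\<^sup>2) * sqrt (2 / pi)\<bar>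
           \<le> 4 * pi * C / (3 * sqrt 3) * (\<mu> / \<sigma>\<^sup>2)"
proof -
  define V where "V = (\<Sum>k=1..b. (c k)\<^sup>2)"
  define S where "S = (\<lambda>\<omega>. \<Sum>k=1..b. c k * \<eta> k \<omega>)"
  have C0: "C \<ge> 0" using C by (rule nonuniform_berry_esseen_nonneg)
  have V0: "V \<ge> 0" unfolding V_def by (intro sum_nonneg) auto
  have S_int: "integrable M S"
    unfolding S_def using int by (intro Bochner_Integration.integrable_sum integrable_mult_right) auto
  have "\<bar>expectation (\<lambda>\<omega>. \<bar>S \<omega>\<bar>) - \<sigma> * sqrt V * sqrt (2 / pi)\<bar> \<le> 4 * pi * C / (3 * sqrt 3) * (\<mu> / \<sigma>\<^sup>2)"
  proof (cases "V = 0")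
    \<comment> \<open>If all weights vanish, the sum cannot be normalised, but it is identically
      zero.\<close>
    case True
    then have "\<forall>k\<in>{1..b}. (c k)\<^sup>2 = 0"
      unfolding V_def by (subst (asm) sum_nonneg_eq_0_iff) auto
    then have "S = (\<lambda>\<omega>. 0)" unfolding S_def by (auto intro!: ext sum.neutral)
    then show ?thesis using True C0 \<mu> by simp
  next
    case False
    then have V: "V > 0" using V0 by simp
    define B where "B = \<sigma>\<^sup>2 * V"
    have B: "B > 0" using \<sigma> V by (simp add: B_def)
    have sqrtB: "sqrt B = \<sigma> * sqrt V" using \<sigma> by (simp add: B_def real_sqrt_mult)
    define X where "X = (\<lambda>k \<omega>. c k * \<eta> k \<omega>)"
    have indX: "indep_vars (\<lambda>_. borel) X {1..b}"
      unfolding X_def using ind by (rule indep_vars_compose2) simp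
    define T where "T = (\<Sum>k=1..b. expectation (\<lambda>\<omega>. \<bar>X k \<omega>\<bar> ^ 3))"
    define K where "K = C * (T / B powr (3/2))"
    define P where "P = distr M borel (\<lambda>\<omega>. S \<omega> / sqrt B)"
    have Y: "(\<lambda>\<omega>. S \<omega> / sqrt B) \<in> borel_measurable M" using S_int by auto
    have P: "real_distribution P" unfolding P_def using Y by (rule real_distribution_distr)
    have BX: "B = (\<Sum>k=1..b. expectation (\<lambda>\<omega>. \<bar>X k \<omega>\<bar>\<^sup>2))"
    proof -
      have "(\<Sum>k=1..b. expectation (\<lambda>\<omega>. \<bar>X k \<omega>\<bar>\<^sup>2)) = (\<Sum>k=1..b. (c k)\<^sup>2 * \<sigma>\<^sup>2)"
        using var by (intro sum.cong) (auto simp: X_def power_mult_distrib)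
      then show ?thesis by (simp add: B_def V_def sum_distrib_left mult.commute)
    qed
    have cdfP: "cdf P x = measure M {\<omega> \<in> space M. (1 / sqrt B) * (\<Sum>k=1..b. X k \<omega>) \<le> x}" for x
      unfolding P_def cdf_def using Y
      by (subst measure_distr) (auto simp: S_def X_def vimage_def Int_def conj_commute intro!: arg_cong [of _ _ "measure M"])
    have "\<bar>cdf P x - cdf std_normal_distribution x\<bar> \<le> K * (1 / (1 + \<bar>x\<bar> ^ 3))" for x
      unfolding cdfP K_def T_def
    proof (rule nonuniform_berry_esseenD [OF C prob_space_axioms indX])
      show "integrable M (\<lambda>\<omega>. \<bar>X k \<omega>\<bar> ^ 3)" if "k \<in> {1..b}" for k
        using int3 [OF that] by (auto simp: X_def abs_mult power_mult_distrib)
      show "expectation (X k) = 0" if "k \<in> {1..b}" for k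
        using mean [OF that] by (simp add: X_def)
    qed (use BX B in auto)
    moreover have "integrable P (\<lambda>x. \<bar>x\<bar>)"
      unfolding P_def using Y S_int by (subst integrable_distr_eq) auto
    ultimately have "\<bar>(\<integral>x. \<bar>x\<bar> \<partial>P) - sqrt (2 / pi)\<bar> \<le> K * (4 * pi / (3 * sqrt 3))"
      using P by (intro abs_moment_diff_std_normal_le)
    also have "(\<integral>x. \<bar>x\<bar> \<partial>P) = expectation (\<lambda>\<omega>. \<bar>S \<omega>\<bar>) / sqrt B"
      unfolding P_def using Y B by (subst integral_distr) auto
    finally have "sqrt B * \<bar>expectation (\<lambda>\<omega>. \<bar>S \<omega>\<bar>) / sqrt B - sqrt (2 / pi)\<bar> \<le> sqrt B * (K * (4 * pi / (3 * sqrt 3)))"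
      using B by (intro mult_left_mono) auto
    also have "sqrt B * \<bar>expectation (\<lambda>\<omega>. \<bar>S \<omega>\<bar>) / sqrt B - sqrt (2 / pi)\<bar>
        = \<bar>sqrt B * (expectation (\<lambda>\<omega>. \<bar>S \<omega>\<bar>) / sqrt B - sqrt (2 / pi))\<bar>"
      using B by (simp add: abs_mult)
    also have "sqrt B * (expectation (\<lambda>\<omega>. \<bar>S \<omega>\<bar>) / sqrt B - sqrt (2 / pi)) = expectation (\<lambda>\<omega>. \<bar>S \<omega>\<bar>) - \<sigma> * sqrt V * sqrt (2 / pi)"
      using B by (simp add: right_diff_distrib sqrtB [symmetric])
    also have "sqrt B * (K * (4 * pi / (3 * sqrt 3))) = 4 * pi * C / (3 * sqrt 3) * (T / B)"
    proof -
      have "B powr (3/2) = B * sqrt B"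
        using B powr_add [of B 1 "1/2"] by (simp add: powr_half_sqrt)
      then have "sqrt B * K = C * (T / B)" using B by (simp add: K_def)
      then have "sqrt B * K * (4 * pi / (3 * sqrt 3)) = C * (T / B) * (4 * pi / (3 * sqrt 3))" by simp
      then show ?thesis by (simp add: mult_ac)
    qed
    also have "\<dots> \<le> 4 * pi * C / (3 * sqrt 3) * (\<mu> / \<sigma>\<^sup>2)"
    proof (rule mult_left_mono)
      \<comment> \<open>Since \<open>\<bar>c k\<bar> \<le> 1\<close>, the cubes of the weights are
        bounded by their squares, which sum to \<open>V\<close>. The same \<open>V\<close> occurs in
        \<open>B\<close> and cancels.\<close>
      have "T = (\<Sum>k=1..b. \<bar>c k\<bar> ^ 3 * \<mu>)"
        unfolding T_def using third by (intro sum.cong) (auto simp: X_def abs_mult power_mult_distrib)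
      also have "\<dots> \<le> (\<Sum>k=1..b. (c k)\<^sup>2 * \<mu>)"
      proof (intro sum_mono mult_right_mono \<mu>)
        fix k assume "k \<in> {1..b}"
        then have "\<bar>c k\<bar> ^ 3 \<le> \<bar>c k\<bar>\<^sup>2" using c by (intro power_decreasing) auto
        then show "\<bar>c k\<bar> ^ 3 \<le> (c k)\<^sup>2" by simp
      qed
      also have "\<dots> = V * \<mu>" by (simp add: V_def sum_distrib_right)
      finally have "T / B \<le> V * \<mu> / B" using B by (intro divide_right_mono) auto
      then show "T / B \<le> \<mu> / \<sigma>\<^sup>2" using V \<sigma> by (simp add: B_def)
    qed (use C0 in simp)
    finally show ?thesis .
  qed
  then show ?thesis by (simp add: V_def S_def)
qed

text \<open>The number \<open>u\<close> is the product of \<open>sqrt (1 + u) - 1\<close> and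
  \<open>sqrt (1 + u) + 1\<close>, and the second factor is at least \<open>1\<close>.\<close>

lemma abs_sqrt_one_plus_minus_one_le:
  fixes u :: real
  assumes "u \<ge> - 1"
  shows "\<bar>sqrt (1 + u) - 1\<bar> \<le> \<bar>u\<bar>"
proof -
  have "\<bar>u\<bar> = \<bar>(sqrt (1 + u) - 1) * (sqrt (1 + u) + 1)\<bar>"
    using assms by (simp add: algebra_simps)
  also have "\<dots> = \<bar>sqrt (1 + u) - 1\<bar> * (sqrt (1 + u) + 1)"
    using assms by (simp add: abs_mult)
  also have "\<dots> \<ge> \<bar>sqrt (1 + u) - 1\<bar> * 1"
    using assms by (intro mult_left_mono) auto
  finally show ?thesis by simp
qed

lemma sum_cos_squared: "(\<Sum>k=1..b. (cos (real k * t))\<^sup>2) = (real b + cos_sum b (2 * t)) / 2"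
proof -
  have "(cos (real k * t))\<^sup>2 = (1 + cos (real k * (2 * t))) / 2" for k
    using cos_double_cos [of "real k * t"] by (simp add: mult.left_commute)
  then have "(\<Sum>k=1..b. (cos (real k * t))\<^sup>2) = (\<Sum>k=1..b. (1 + cos (real k * (2 * t))) / 2)"
    by (simp only:)
  also have "\<dots> = (real b + cos_sum b (2 * t)) / 2"
    by (simp add: cos_sum_def sum.distrib flip: sum_divide_distrib)
  finally show ?thesis .
qed

text \<open>The three error terms come from the normal approximation of the centered sum
  \<open>S\<close>, from the mean \<open>a\<close>, and from replacing the variance of
  \<open>S\<close> by \<open>\<sigma>\<^sup>2 * b / 2\<close>. The factor \<open>2\<close> in the
  eigenvalue doubles each of them.\<close>

lemma (in prob_space) expectation_abs_circulant_eigenvalue: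
  fixes \<xi> :: "nat \<Rightarrow> 'a \<Rightarrow> real" and j n :: nat
  assumes C: "nonuniform_berry_esseen C" and b: "b \<ge> 1"
    and ind: "indep_vars (\<lambda>_. borel) \<xi> {1..b}"
    and int: "\<And>k. k \<in> {1..b} \<Longrightarrow> integrable M (\<xi> k)"
    and int3: "\<And>k. k \<in> {1..b} \<Longrightarrow> integrable M (\<lambda>\<omega>. \<bar>\<xi> k \<omega> - a\<bar> ^ 3)"
    and mean: "\<And>k. k \<in> {1..b} \<Longrightarrow> expectation (\<xi> k) = a"
    and var: "\<And>k. k \<in> {1..b} \<Longrightarrow> expectation (\<lambda>\<omega>. \<bar>\<xi> k \<omega> - a\<bar>\<^sup>2) = \<sigma>\<^sup>2"
    and third: "\<And>k. k \<in> {1..b} \<Longrightarrow> expectation (\<lambda>\<omega>. \<bar>\<xi> k \<omega> - a\<bar> ^ 3) = \<mu>"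
    and \<sigma>: "\<sigma> > 0" and \<mu>: "\<mu> \<ge> 0"
  defines "t \<equiv> 2 * pi * real j / real n"
  shows "\<bar>expectation (\<lambda>\<omega>. \<bar>circulant_eigenvalue n b (\<lambda>k. \<xi> k \<omega>) j\<bar>) - 2 * \<sigma> * sqrt b / sqrt pi\<bar>
           \<le> 8 * pi * C / (3 * sqrt 3) * (\<mu> / \<sigma>\<^sup>2) + 2 * \<bar>a\<bar> * \<bar>cos_sum b t\<bar>
             + 2 * \<sigma> / sqrt (pi * b) * \<bar>cos_sum b (2 * t)\<bar>"
proof -
  define S where "S = (\<lambda>\<omega>. \<Sum>k=1..b. cos (real k * t) * (\<xi> k \<omega> - a))"
  define V where "V = (\<Sum>k=1..b. (cos (real k * t))\<^sup>2)"
  have S_int: "integrable M S"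
    unfolding S_def using int by (intro Bochner_Integration.integrable_sum integrable_mult_right) auto
  have ev: "circulant_eigenvalue n b (\<lambda>k. \<xi> k \<omega>) j = 2 * (a * cos_sum b t + S \<omega>)" for \<omega>
  proof -
    have "a * cos_sum b t + S \<omega> = (\<Sum>k=1..b. \<xi> k \<omega> * cos (real k * t))"
      unfolding S_def cos_sum_def sum_distrib_left sum.distrib [symmetric]
      by (intro sum.cong) (auto simp: algebra_simps)
    then show ?thesis by (simp add: circulant_eigenvalue_def t_def mult_ac)
  qed
  have ev_int: "integrable M (\<lambda>\<omega>. \<bar>2 * (a * cos_sum b t + S \<omega>)\<bar>)"
    using S_int by (intro integrable_abs integrable_mult_right) auto
  have "\<bar>expectation (\<lambda>\<omega>. \<bar>S \<omega>\<bar>) - \<sigma> * sqrt V * sqrt (2 / pi)\<bar> \<le> 4 * pi * C / (3 * sqrt 3) * (\<mu> / \<sigma>\<^sup>2)"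
    unfolding S_def V_def
  proof (rule weighted_sum_abs_moment [OF C, where \<eta> = "\<lambda>k \<omega>. \<xi> k \<omega> - a"])
    show "indep_vars (\<lambda>_. borel) (\<lambda>k \<omega>. \<xi> k \<omega> - a) {1..b}"
      using ind by (rule indep_vars_compose2) simp
    show "expectation (\<lambda>\<omega>. \<xi> k \<omega> - a) = 0" if "k \<in> {1..b}" for k
      using int mean that by (simp add: prob_space)
  qed (use int int3 var third \<sigma> \<mu> in auto)
  moreover have "\<bar>expectation (\<lambda>\<omega>. \<bar>2 * (a * cos_sum b t + S \<omega>)\<bar>) - 2 * expectation (\<lambda>\<omega>. \<bar>S \<omega>\<bar>)\<bar>
      \<le> 2 * \<bar>a\<bar> * \<bar>cos_sum b t\<bar>"
  proof -
    have "\<bar>expectation (\<lambda>\<omega>. \<bar>2 * (a * cos_sum b t + S \<omega>)\<bar>) - 2 * expectation (\<lambda>\<omega>. \<bar>S \<omega>\<bar>)\<bar>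
      = \<bar>expectation (\<lambda>\<omega>. \<bar>2 * (a * cos_sum b t + S \<omega>)\<bar> - 2 * \<bar>S \<omega>\<bar>)\<bar>"
      using ev_int S_int by simp
    also have "\<dots> \<le> expectation (\<lambda>\<omega>. \<bar>\<bar>2 * (a * cos_sum b t + S \<omega>)\<bar> - 2 * \<bar>S \<omega>\<bar>\<bar>)"
      by (rule integral_abs_bound)
    also have "\<dots> \<le> expectation (\<lambda>\<omega>. 2 * \<bar>a * cos_sum b t\<bar>)"
      using ev_int S_int by (intro integral_mono) auto
    also have "\<dots> = 2 * \<bar>a\<bar> * \<bar>cos_sum b t\<bar>" by (simp add: prob_space abs_mult)
    finally show ?thesis .
  qed
  moreover have "\<bar>2 * (\<sigma> * sqrt V * sqrt (2 / pi)) - 2 * \<sigma> * sqrt b / sqrt pi\<bar>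
      \<le> 2 * \<sigma> / sqrt (pi * b) * \<bar>cos_sum b (2 * t)\<bar>"
  proof -
    \<comment> \<open>\<open>u\<close> is the relative deviation of \<open>V\<close> from
      \<open>b / 2\<close>. Being a sum of squares, \<open>V\<close> is nonnegative, which gives
      \<open>u \<ge> - 1\<close>.\<close>
    define u where "u = cos_sum b (2 * t) / real b"
    have V: "V = real b / 2 * (1 + u)"
      unfolding V_def sum_cos_squared u_def using b by (simp add: field_simps)
    have "V \<ge> 0" unfolding V_def by (intro sum_nonneg) auto
    then have u: "u \<ge> - 1" using b by (simp add: V zero_le_mult_iff)
    have "sqrt V * sqrt (2 / pi) = sqrt (real b / pi * (1 + u))"
      unfolding real_sqrt_mult [symmetric] V by simp
    also have "\<dots> = sqrt b / sqrt pi * sqrt (1 + u)"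
      by (simp only: real_sqrt_mult real_sqrt_divide)
    finally have "2 * (\<sigma> * sqrt V * sqrt (2 / pi)) - 2 * \<sigma> * sqrt b / sqrt pi
        = 2 * \<sigma> * sqrt b / sqrt pi * (sqrt (1 + u) - 1)"
      by (simp add: mult.assoc right_diff_distrib)
    then have "\<bar>2 * (\<sigma> * sqrt V * sqrt (2 / pi)) - 2 * \<sigma> * sqrt b / sqrt pi\<bar>
        = 2 * \<sigma> * sqrt b / sqrt pi * \<bar>sqrt (1 + u) - 1\<bar>"
      using \<sigma> by (simp add: abs_mult)
    also have "\<dots> \<le> 2 * \<sigma> * sqrt b / sqrt pi * \<bar>u\<bar>"
      using \<sigma> u by (intro mult_left_mono abs_sqrt_one_plus_minus_one_le) auto
    also have "\<dots> = 2 * \<sigma> / sqrt pi * (sqrt b / b) * \<bar>cos_sum b (2 * t)\<bar>"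
      using b by (simp add: u_def abs_divide)
    also have "sqrt b / b = 1 / sqrt b" using b by (simp add: real_div_sqrt field_simps)
    finally show ?thesis by (simp add: real_sqrt_mult)
  qed
  ultimately show ?thesis unfolding ev by (simp add: abs_le_iff)
qed

section \<open>The expected energy\<close>

text \<open>The filter sends \<open>b\<close> to infinity and constrains \<open>n\<close> only by
  \<open>n > 2 * b\<close>, so the estimate has to be uniform in \<open>n\<close>. Eventually
  \<open>b \<ge> 3\<close>, where the comparison function is nonnegative.\<close>

lemma ln_over_sqrt_bigo:
  fixes f :: "nat \<Rightarrow> nat \<Rightarrow> real"
  assumes "\<And>n b. b \<ge> 3 \<Longrightarrow> n > 2 * b \<Longrightarrow> \<bar>f n b\<bar> \<le> K * (ln (real b) / sqrt (real b))"
  shows "(\<lambda>(n, b). f n b)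
     \<in> O[inf (filtercomap snd at_top) (principal {(n, b). n > 2 * b})](\<lambda>(n, b). ln (real b) / sqrt (real b))"
proof (rule bigoI [where c = K])
  have "eventually (\<lambda>p :: nat \<times> nat. 3 \<le> snd p) (filtercomap snd at_top)"
    by (rule eventually_filtercomapI) (rule eventually_ge_at_top)
  then show "eventually (\<lambda>p. norm (case p of (n, b) \<Rightarrow> f n b)
      \<le> K * norm (case p of (n, b) \<Rightarrow> ln (real b) / sqrt (real b)))
      (inf (filtercomap snd at_top) (principal {(n :: nat, b :: nat). n > 2 * b}))"
    unfolding eventually_inf_principal
    by (rule eventually_mono) (use assms in \<open>auto simp: abs_of_nonneg split: prod.splits\<close>)
qed

text \<open>From \<open>b \<ge> 3 > exp 1\<close> one has \<open>L \<ge> 1\<close>, so constants can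
  be absorbed into multiples of \<open>L\<close>. Each of the three summands is then at most a
  constant times \<open>L / sqrt b\<close>.\<close>

lemma energy_bound_le_ln_over_sqrt:
  fixes c a \<sigma> \<gamma> :: real and n b :: nat
  assumes b: "b \<ge> 3" and n: "n > 2 * b" and \<sigma>: "\<sigma> \<ge> 0" and \<gamma>: "\<gamma> \<ge> 0"
  defines "L \<equiv> ln (real b)"
  shows "\<bar>c / sqrt b + 4 / sqrt b * (\<bar>a\<bar> + \<sigma> / sqrt (pi * b)) * (1 + 1 / pi\<^sup>2 * L)
         + 2 / (n * sqrt b) * (\<bar>a\<bar> + 2 * \<sigma> / sqrt (pi * b)) * (1 + (2 * real b + 1) * (1 + \<gamma> + L))\<bar>
         \<le> (\<bar>c\<bar> + 8 * (\<bar>a\<bar> + \<sigma>) + 2 * (\<bar>a\<bar> + 2 * \<sigma>) * (3 + \<gamma>)) * (L / sqrt b)"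
proof -
  define s where "s = sqrt (real b)"
  define q where "q = sqrt (pi * real b)"
  have s: "s > 0" using b by (simp add: s_def)
  have L: "L \<ge> 1"
    unfolding L_def using b exp_le by (subst ln_ge_iff) auto
  have "1 * 1 \<le> pi * real b" using b pi_gt3 by (intro mult_mono) auto
  then have q: "q \<ge> 1" by (simp add: q_def)
  have \<sigma>q: "0 \<le> \<sigma> / q" "\<sigma> / q \<le> \<sigma>"
    using q \<sigma> mult_left_mono [of 1 q \<sigma>] by (auto simp: field_simps)
  have "1 * 1 \<le> pi\<^sup>2" unfolding power2_eq_square using pi_gt3 by (intro mult_mono) auto
  then have piL: "1 / pi\<^sup>2 * L \<le> L" "0 \<le> 1 / pi\<^sup>2 * L"
    using L mult_right_mono [of 1 "pi\<^sup>2" L] by (auto simp: field_simps)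
  define X where "X = c / s"
  define Y where "Y = 4 / s * (\<bar>a\<bar> + \<sigma> / q) * (1 + 1 / pi\<^sup>2 * L)"
  define Z where "Z = 2 / (n * s) * (\<bar>a\<bar> + 2 * \<sigma> / q) * (1 + (2 * real b + 1) * (1 + \<gamma> + L))"
  have "\<bar>X\<bar> = \<bar>c\<bar> * (1 / s)" using s by (simp add: X_def abs_divide)
  also have "\<dots> \<le> \<bar>c\<bar> * (L / s)"
    using L s by (intro mult_left_mono divide_right_mono) auto
  finally have X: "\<bar>X\<bar> \<le> \<bar>c\<bar> * (L / s)" .
  have "Y \<le> 4 / s * (\<bar>a\<bar> + \<sigma>) * (2 * L)"
    unfolding Y_def using s \<sigma>q piL L \<sigma> by (intro mult_mono) auto
  moreover have "Y \<ge> 0"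
    unfolding Y_def using s \<sigma>q piL by (intro mult_nonneg_nonneg) auto
  moreover have "4 / s * (\<bar>a\<bar> + \<sigma>) * (2 * L) = 8 * (\<bar>a\<bar> + \<sigma>) * (L / s)"
    using s by (simp add: field_simps)
  ultimately have Y: "\<bar>Y\<bar> \<le> 8 * (\<bar>a\<bar> + \<sigma>) * (L / s)" by (simp only: abs_of_nonneg)
  \<comment> \<open>Because \<open>2 * b + 1 \<le> n\<close>, the linear growth in \<open>b\<close>
    is cancelled by the factor \<open>1 / n\<close> of the third summand.\<close>
  have "1 + (2 * real b + 1) * (1 + \<gamma> + L) \<le> n * ((3 + \<gamma>) * L)"
  proof -
    have "(2 * real b + 1) * (1 + \<gamma> + L) \<le> n * (1 + \<gamma> + L)"
      using n \<gamma> L by (intro mult_right_mono) auto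
    moreover have "1 \<le> real n" using n by simp
    ultimately have "1 + (2 * real b + 1) * (1 + \<gamma> + L) \<le> n * (2 + \<gamma> + L)"
      by (simp add: algebra_simps)
    also have "\<dots> \<le> n * ((3 + \<gamma>) * L)"
    proof (rule mult_left_mono)
      have "(2 + \<gamma>) * 1 \<le> (2 + \<gamma>) * L" using L \<gamma> by (intro mult_left_mono) auto
      then show "2 + \<gamma> + L \<le> (3 + \<gamma>) * L" by (simp add: algebra_simps)
    qed simp
    finally show ?thesis .
  qed
  moreover have "2 * \<sigma> / q \<le> 2 * \<sigma>" using \<sigma>q by simp
  ultimately have "Z \<le> 2 / (n * s) * (\<bar>a\<bar> + 2 * \<sigma>) * (n * ((3 + \<gamma>) * L))"
    unfolding Z_def using s \<sigma>q \<gamma> L \<sigma> by (intro mult_mono) auto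
  also have "\<dots> = 2 * (\<bar>a\<bar> + 2 * \<sigma>) * (3 + \<gamma>) * (L / s)"
    using n s by simp
  finally have "Z \<le> \<dots>" .
  moreover have "Z \<ge> 0"
    unfolding Z_def using s \<sigma> q \<gamma> L by (intro mult_nonneg_nonneg add_nonneg_nonneg) auto
  ultimately have Z: "\<bar>Z\<bar> \<le> 2 * (\<bar>a\<bar> + 2 * \<sigma>) * (3 + \<gamma>) * (L / s)" by simp
  have "\<bar>X + Y + Z\<bar> \<le> \<bar>c\<bar> * (L / s) + 8 * (\<bar>a\<bar> + \<sigma>) * (L / s) + 2 * (\<bar>a\<bar> + 2 * \<sigma>) * (3 + \<gamma>) * (L / s)"
    using X Y Z by linarith
  also have "\<dots> = (\<bar>c\<bar> + 8 * (\<bar>a\<bar> + \<sigma>) + 2 * (\<bar>a\<bar> + 2 * \<sigma>) * (3 + \<gamma>)) * (L / s)"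
    by (simp only: distrib_right)
  finally show ?thesis by (simp only: X_def Y_def Z_def s_def q_def)
qed

text \<open>The energy is the sum of the absolute eigenvalues, so the estimate for one eigenvalue is
  averaged over \<open>j\<close>. The averages \<open>A1\<close> and \<open>A2\<close> of the two
  cosine sums are then bounded by the Riemann sum estimate.\<close>

lemma (in prob_space) expected_energy_bound:
  fixes \<xi> :: "nat \<Rightarrow> 'a \<Rightarrow> real"
  assumes C: "nonuniform_berry_esseen C" and b: "b \<ge> 1" and n: "2 * b < n"
    and ind: "indep_vars (\<lambda>_. borel) \<xi> {1..b}"
    and int: "\<And>k. k \<in> {1..b} \<Longrightarrow> integrable M (\<xi> k)"
    and int3: "\<And>k. k \<in> {1..b} \<Longrightarrow> integrable M (\<lambda>\<omega>. \<bar>\<xi> k \<omega> - a\<bar> ^ 3)"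
    and mean: "\<And>k. k \<in> {1..b} \<Longrightarrow> expectation (\<xi> k) = a"
    and var: "\<And>k. k \<in> {1..b} \<Longrightarrow> expectation (\<lambda>\<omega>. \<bar>\<xi> k \<omega> - a\<bar>\<^sup>2) = \<sigma>\<^sup>2"
    and third: "\<And>k. k \<in> {1..b} \<Longrightarrow> expectation (\<lambda>\<omega>. \<bar>\<xi> k \<omega> - a\<bar> ^ 3) = \<mu>"
    and \<sigma>: "\<sigma> > 0" and \<mu>: "\<mu> \<ge> 0"
  defines "energy \<equiv> \<lambda>\<omega>. matrix_energy (band_circulant n b (\<lambda>k. \<xi> k \<omega>))"
  shows "integrable M energy"
    and "\<bar>1 / (n * sqrt b) * expectation energy - 2 * \<sigma> / sqrt pi\<bar>
      \<le> 8 * pi * C / (3 * sqrt 3) * (\<mu> / (\<sigma>\<^sup>2 * sqrt b))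
         + 4 / sqrt b * (\<bar>a\<bar> + \<sigma> / sqrt (pi * b)) * (1 + 1 / pi\<^sup>2 * ln b)
         + 2 / (n * sqrt b) * (\<bar>a\<bar> + 2 * \<sigma> / sqrt (pi * b))
             * (1 + (2 * real b + 1) * (1 + euler_mascheroni + ln b))"
proof -
  define ev where "ev = (\<lambda>j \<omega>. \<bar>circulant_eigenvalue n b (\<lambda>k. \<xi> k \<omega>) j\<bar>)"
  have energy: "energy = (\<lambda>\<omega>. \<Sum>j<n. ev j \<omega>)"
    unfolding energy_def ev_def using n by (simp add: matrix_energy_band_circulant)
  have ev_int: "integrable M (ev j)" for j
    unfolding ev_def circulant_eigenvalue_def using int
    by (intro integrable_abs integrable_mult_right Bochner_Integration.integrable_sum integrable_mult_left) auto
  then show "integrable M energy" unfolding energy by (intro Bochner_Integration.integrable_sum)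
  define T where "T = 8 * pi * C / (3 * sqrt 3) * (\<mu> / \<sigma>\<^sup>2)"
  define L where "L = ln (real b)"
  define W where "W = 1 + (2 * real b + 1) * (1 + euler_mascheroni + L)"
  define q where "q = sqrt (pi * real b)"
  define A1 where "A1 = (\<Sum>j<n. \<bar>cos_sum b (2 * pi * real j / real n)\<bar>) / real n"
  define A2 where "A2 = (\<Sum>j<n. \<bar>cos_sum b (2 * (2 * pi * real j / real n))\<bar>) / real n"
  have n0: "real n > 0" "n \<ge> 1" and b0: "real b > 0" using n b by auto
  have A1: "A1 \<le> 2 + 2 / pi\<^sup>2 * L + 1 / n * W"
    using sum_abs_cos_sum_le [OF b n0(2), of 1] by (simp add: A1_def L_def W_def)
  have A2: "A2 \<le> 2 + 2 / pi\<^sup>2 * L + 2 / n * W"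
    \<comment> \<open>The doubled angle makes the nodes go round the circle twice. This doubles the
      error of order \<open>W / n\<close> and explains the factor \<open>2\<close> before
      \<open>\<sigma>\<close> in the last term of the bound.\<close>
    using sum_abs_cos_sum_le [OF b n0(2), of 2] by (simp add: A2_def L_def W_def mult_ac)
  have q: "q > 0" using b0 by (simp add: q_def)
  have "\<bar>expectation energy - n * (2 * \<sigma> * sqrt b / sqrt pi)\<bar>
      = \<bar>\<Sum>j<n. expectation (ev j) - 2 * \<sigma> * sqrt b / sqrt pi\<bar>"
    unfolding energy using ev_int by (simp add: sum_subtractf)
  also have "\<dots> \<le> (\<Sum>j<n. \<bar>expectation (ev j) - 2 * \<sigma> * sqrt b / sqrt pi\<bar>)"
    by (rule sum_abs)
  also have "\<dots> \<le> (\<Sum>j<n. T + 2 * \<bar>a\<bar> * \<bar>cos_sum b (2 * pi * real j / real n)\<bar>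
      + 2 * \<sigma> / q * \<bar>cos_sum b (2 * (2 * pi * real j / real n))\<bar>)"
    unfolding ev_def T_def q_def
    by (intro sum_mono expectation_abs_circulant_eigenvalue [OF C b ind int int3 mean var third \<sigma> \<mu>])
  also have "\<dots> = n * (T + 2 * \<bar>a\<bar> * A1 + 2 * \<sigma> / q * A2)"
    unfolding A1_def A2_def sum.distrib sum_distrib_left [symmetric] using n0 by (simp add: distrib_left)
  finally have "\<bar>expectation energy - n * (2 * \<sigma> * sqrt b / sqrt pi)\<bar> / (n * sqrt b)
      \<le> n * (T + 2 * \<bar>a\<bar> * A1 + 2 * \<sigma> / q * A2) / (n * sqrt b)"
    by (rule divide_right_mono) simp
  also have "n * (T + 2 * \<bar>a\<bar> * A1 + 2 * \<sigma> / q * A2) / (n * sqrt b) = (T + 2 * \<bar>a\<bar> * A1 + 2 * \<sigma> / q * A2) / sqrt b"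
    using n0 by simp
  also have "\<dots> \<le> (T + 2 * \<bar>a\<bar> * (2 + 2 / pi\<^sup>2 * L + 1 / n * W) + 2 * \<sigma> / q * (2 + 2 / pi\<^sup>2 * L + 2 / n * W)) / sqrt b"
    using A1 A2 \<sigma> q by (intro divide_right_mono add_mono mult_left_mono) auto
  also have "\<bar>expectation energy - n * (2 * \<sigma> * sqrt b / sqrt pi)\<bar> / (n * sqrt b)
      = \<bar>(expectation energy - n * (2 * \<sigma> * sqrt b / sqrt pi)) / (n * sqrt b)\<bar>"
    using n0 by (simp add: abs_divide)
  also have "(expectation energy - n * (2 * \<sigma> * sqrt b / sqrt pi)) / (n * sqrt b)
      = 1 / (n * sqrt b) * expectation energy - 2 * \<sigma> / sqrt pi"
    using n0 b0 by (simp add: diff_divide_distrib)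
  also have "(T + 2 * \<bar>a\<bar> * (2 + 2 / pi\<^sup>2 * L + 1 / n * W) + 2 * \<sigma> / q * (2 + 2 / pi\<^sup>2 * L + 2 / n * W)) / sqrt b
      = T / sqrt b + 4 / sqrt b * (\<bar>a\<bar> + \<sigma> / q) * (1 + 1 / pi\<^sup>2 * L)
        + 2 / (n * sqrt b) * (\<bar>a\<bar> + 2 * \<sigma> / q) * W"
    using n0 b0 q by (simp add: field_simps)
  finally show "\<bar>1 / (n * sqrt b) * expectation energy - 2 * \<sigma> / sqrt pi\<bar>
      \<le> 8 * pi * C / (3 * sqrt 3) * (\<mu> / (\<sigma>\<^sup>2 * sqrt b))
         + 4 / sqrt b * (\<bar>a\<bar> + \<sigma> / sqrt (pi * b)) * (1 + 1 / pi\<^sup>2 * ln b)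
         + 2 / (n * sqrt b) * (\<bar>a\<bar> + 2 * \<sigma> / sqrt (pi * b))
             * (1 + (2 * real b + 1) * (1 + euler_mascheroni + ln b))"
    by (simp add: T_def L_def W_def q_def)
qed

text \<open>The moment assumptions on the common law \<open>D\<close> are transferred to each
  \<open>\<xi> k\<close> by the change of variables formula, after which
  \<open>expected_energy_bound\<close> applies. The order of the right-hand side follows from an
  estimate whose constant depends only on \<open>C1\<close> and the moments of
  \<open>D\<close>.\<close>

theorem theorem1:
  fixes C1 a \<sigma> \<mu>3 :: real and D :: "real measure"
  assumes "best_nonuniform_berry_esseen C1" and "C1 < 31.954"
    and "real_distribution D"
    and "integrable D (\<lambda>x. x)" and "a = (\<integral>x. x \<partial>D)"
    and "integrable D (\<lambda>x. \<bar>x - a\<bar>\<^sup>2)" and "\<sigma>\<^sup>2 = (\<integral>x. \<bar>x - a\<bar>\<^sup>2 \<partial>D)" and "\<sigma> > 0"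
    and "integrable D (\<lambda>x. \<bar>x - a\<bar> ^ 3)" and "\<mu>3 = (\<integral>x. \<bar>x - a\<bar> ^ 3 \<partial>D)"
  shows
    "let R = (\<lambda>(n::nat) (b::nat).
         8 * pi * C1 / (3 * sqrt 3) * (\<mu>3 / (\<sigma>\<^sup>2 * sqrt b))
         + 4 / sqrt b * (\<bar>a\<bar> + \<sigma> / sqrt (pi * b)) * (1 + 1 / pi\<^sup>2 * ln b)
         + 2 / (n * sqrt b) * (\<bar>a\<bar> + 2 * \<sigma> / sqrt (pi * b))
             * (1 + (2 * b + 1) * (1 + euler_mascheroni + ln b)))
     in
       (\<forall>(M :: 'a measure) (\<xi> :: nat \<Rightarrow> 'a \<Rightarrow> real) (n::nat) (b::nat).
          1 \<le> b \<longrightarrow> real b < real n / 2 \<longrightarrow>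
          prob_space M \<longrightarrow>
          prob_space.indep_vars M (\<lambda>_. borel) \<xi> {1..b} \<longrightarrow>
          (\<forall>k\<in>{1..b}. distr M borel (\<xi> k) = D) \<longrightarrow>
          (let energy = (\<lambda>\<omega>. matrix_energy (band_circulant n b (\<lambda>k. \<xi> k \<omega>))) in
            integrable M energy \<and>
            \<bar>1 / (n * sqrt b) * (\<integral>\<omega>. energy \<omega> \<partial>M) - 2 * \<sigma> / sqrt pi\<bar> \<le> R n b))
       \<and>
       (\<lambda>(n, b). R n b)
         \<in> O[inf (filtercomap snd at_top) (principal {(n, b). n > 2 * b})](\<lambda>(n, b). ln (real b) / sqrt (real b))"
proof -
  have C: "nonuniform_berry_esseen C1"
    using assms(1) by (simp add: best_nonuniform_berry_esseen_def)
  have \<mu>: "\<mu>3 \<ge> 0" using assms(10) by simp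
  have energy: "integrable M (\<lambda>\<omega>. matrix_energy (band_circulant n b (\<lambda>k. \<xi> k \<omega>)))
      \<and> \<bar>1 / (n * sqrt b) * (\<integral>\<omega>. matrix_energy (band_circulant n b (\<lambda>k. \<xi> k \<omega>)) \<partial>M) - 2 * \<sigma> / sqrt pi\<bar>
      \<le> 8 * pi * C1 / (3 * sqrt 3) * (\<mu>3 / (\<sigma>\<^sup>2 * sqrt b))
         + 4 / sqrt b * (\<bar>a\<bar> + \<sigma> / sqrt (pi * b)) * (1 + 1 / pi\<^sup>2 * ln b)
         + 2 / (n * sqrt b) * (\<bar>a\<bar> + 2 * \<sigma> / sqrt (pi * b))
             * (1 + real (2 * b + 1) * (1 + euler_mascheroni + ln b))"
    if b: "1 \<le> b" and n: "real b < real n / 2" and M: "prob_space M"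
      and ind: "prob_space.indep_vars M (\<lambda>_. borel) \<xi> {1..b}"
      and D: "\<forall>k\<in>{1..b}. distr M borel (\<xi> k) = D"
    for M :: "'a measure" and \<xi> :: "nat \<Rightarrow> 'a \<Rightarrow> real" and n b :: nat
  proof -
    interpret prob_space M by fact
    have meas: "\<xi> k \<in> borel_measurable M" if "k \<in> {1..b}" for k
      using ind that by (auto simp: indep_vars_def)
    \<comment> \<open>Integrability and expectation of \<open>g (\<xi> k)\<close> are read off from
      \<open>D\<close>; the choices of \<open>g\<close> below are the identity and the second and
      third absolute powers of \<open>x - a\<close>.\<close>
    have int: "integrable M (\<lambda>\<omega>. g (\<xi> k \<omega>))"
      if "k \<in> {1..b}" "integrable D g" "g \<in> borel_measurable borel" for k and g :: "real \<Rightarrow> real"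
      using that D meas [of k] integrable_distr_eq [of "\<xi> k" M borel g] by simp
    have expect: "expectation (\<lambda>\<omega>. g (\<xi> k \<omega>)) = integral\<^sup>L D g"
      if "k \<in> {1..b}" "g \<in> borel_measurable borel" for k and g :: "real \<Rightarrow> real"
      using that D meas [of k] integral_distr [of "\<xi> k" M borel g] by simp
    have n': "2 * b < n" using n by linarith
    have h1: "integrable M (\<xi> k)" if "k \<in> {1..b}" for k
      by (rule int [OF that assms(4)]) simp
    have h2: "integrable M (\<lambda>\<omega>. \<bar>\<xi> k \<omega> - a\<bar> ^ 3)" if "k \<in> {1..b}" for k
      by (rule int [OF that assms(9)]) simp
    have h3: "expectation (\<xi> k) = a" if "k \<in> {1..b}" for k
      unfolding assms(5) by (rule expect [OF that, of "\<lambda>x. x"]) simp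
    have h4: "expectation (\<lambda>\<omega>. \<bar>\<xi> k \<omega> - a\<bar>\<^sup>2) = \<sigma>\<^sup>2" if "k \<in> {1..b}" for k
      unfolding assms(7) by (rule expect [OF that, of "\<lambda>x. \<bar>x - a\<bar>\<^sup>2"]) simp
    have h5: "expectation (\<lambda>\<omega>. \<bar>\<xi> k \<omega> - a\<bar> ^ 3) = \<mu>3" if "k \<in> {1..b}" for k
      unfolding assms(10) by (rule expect [OF that, of "\<lambda>x. \<bar>x - a\<bar> ^ 3"]) simp
    show ?thesis
      using expected_energy_bound [OF C b n' ind h1 h2 h3 h4 h5 assms(8) \<mu>] by (simp add: add.commute)
  qed
  have odd_eq: "real (2 * b + 1) = 2 * real b + 1" for b by simp
  have asymp: "\<bar>8 * pi * C1 / (3 * sqrt 3) * (\<mu>3 / (\<sigma>\<^sup>2 * sqrt b))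
         + 4 / sqrt b * (\<bar>a\<bar> + \<sigma> / sqrt (pi * b)) * (1 + 1 / pi\<^sup>2 * ln b)
         + 2 / (n * sqrt b) * (\<bar>a\<bar> + 2 * \<sigma> / sqrt (pi * b))
             * (1 + real (2 * b + 1) * (1 + euler_mascheroni + ln b))\<bar>
      \<le> (\<bar>8 * pi * C1 / (3 * sqrt 3) * (\<mu>3 / \<sigma>\<^sup>2)\<bar> + 8 * (\<bar>a\<bar> + \<sigma>)
         + 2 * (\<bar>a\<bar> + 2 * \<sigma>) * (3 + euler_mascheroni)) * (ln b / sqrt b)"
    if "b \<ge> 3" "n > 2 * b" for n b :: nat
    unfolding odd_eq using energy_bound_le_ln_over_sqrt [OF that, of \<sigma> euler_mascheroni "8 * pi * C1 / (3 * sqrt 3) * (\<mu>3 / \<sigma>\<^sup>2)" a]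
      assms(8) euler_mascheroni_pos by (simp add: mult.assoc)
  show ?thesis
    unfolding Let_def
  proof (intro conjI allI impI)
    show "(\<lambda>(n :: nat, b :: nat). 8 * pi * C1 / (3 * sqrt 3) * (\<mu>3 / (\<sigma>\<^sup>2 * sqrt b))
         + 4 / sqrt b * (\<bar>a\<bar> + \<sigma> / sqrt (pi * b)) * (1 + 1 / pi\<^sup>2 * ln b)
         + 2 / (n * sqrt b) * (\<bar>a\<bar> + 2 * \<sigma> / sqrt (pi * b))
             * (1 + real (2 * b + 1) * (1 + euler_mascheroni + ln b)))
         \<in> O[inf (filtercomap snd at_top) (principal {(n :: nat, b :: nat). n > 2 * b})](\<lambda>(n, b). ln (real b) / sqrt (real b))"
      by (rule ln_over_sqrt_bigo) (rule asymp)
  qed (use energy in blast)+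
qed

end
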